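(* Let $v(x)=v_\epsilon(x)\ge0$, $x\in\mathcal X$, satisfy $v(x)=\Theta(\epsilon^{\bar d(x,g)})$ uniformly in $x$, and let $\mathbb Q$ be the path measure built from $v$ and $L_{\mathbb Q}=\mathbb P/\mathbb Q$ the likelihood ratio (see context). If the estimator based on $v$ and $\mathbb Q$ does not have vanishing relative error, i.e. if $\operatorname{Var}_{\mathbb Q}(L_{\mathbb Q}\mathbf 1_\Phi)/(\mathbb E_{\mathbb Q}(L_{\mathbb Q}\mathbf 1_\Phi))^2$ does not tend to $0$ as $\epsilon\downarrow0$, then it has the Bounded Normal Approximation property: $$\frac{\mathbb E_{\mathbb Q}\big(\,|L_{\mathbb Q}\cdot\mathbf 1_\Phi-\mathbb E_{\mathbb Q}(L_{\mathbb Q}\cdot\mathbf 1_\Phi)|^3\big)}{\big(\operatorname{Var}_{\mathbb Q}(L_{\mathbb Q}\cdot\mathbf 1_\Phi)\big)^{3/2}}=O(1)\qquad(\epsilon\downarrow0).$$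
   Context: Markov chain. $\mathcal X$ is a (possibly infinite) countable state space with distinguished states $s$ (initial), $g$ (goal), $t$ (taboo), $s\ne g$, $s\neq t$, and $g,t$ absorbing ($p_{gg}=p_{tt}=1$). The transition probabilities $p_{xz}=p_{xz}(\epsilon)$ depend on a small parameter $\epsilon>0$; for each $x,z$ either $p_{xz}=0$, and then $r_{xz}=\infty$, or $p_{xz}(\epsilon)>0$ with $p_{xz}(\epsilon)=\Theta(\epsilon^{r_{xz}})$ for some $r_{xz}\in\mathbb N=\{0,1,2,\dots\}$. The state space and its transition structure do not depend on $\epsilon$. Asymptotics. $f=\Theta(h)$ means $0<\lim_{\epsilon\downarrow0}f(\epsilon)/h(\epsilon)<\infty$; $f=O(h)$ means $\lim_{\epsilon\downarrow0}f(\epsilon)/h(\epsilon)<\infty$ (limits assumed to exist). $f_y=\Theta(h_y)$ uniformly in $y$ means there are $a,b>0$ with $a<\lim_{\epsilon\downarrow0}f_y(\epsilon)/h_y(\epsilon)<b$ for all $y$ (limits assumed to exist). Convention: $\epsilon^\infty=0$, and $f=\Theta(\epsilon^\infty)$ means $f(\epsilon)=0$ for all small $\epsilon$ (such indices are exempt from the bounds $a,b$). Paths. A path $\omega$ is a finite sequence $\omega(0),\dots,\omega(n_\omega)$ of states, with $n_\omega\ge0$ steps, and $\mathbb P(\omega)=\prod_{i=1}^{n_\omega}p_{\omega(i-1)\omega(i)}$. Distance: $d(x,z)$ is the minimum of those $r\in\mathbb N$ for which there is a path $\omega$ with $\omega(0)=x$, $\omega(n_\omega)=z$, $\omega(k)\notin\{t,g\}$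 for all $k<n_\omega$, and $\mathbb P(\omega)=\Theta(\epsilon^r)$; $d(x,z)=\infty$ if there is none. $\Phi(x)$ is the set of paths with $\omega(0)=x$, $\omega(n_\omega)=g$, $\omega(k)\notin\{t,g\}$ for $k<n_\omega$; $\Phi=\Phi(s)$. Sets. $\Lambda=\{x\in\mathcal X: d(s,x)\le d(s,g)\}$, $\Gamma=\{x\in\mathcal X\setminus\Lambda:\exists z\in\Lambda,\ p_{zx}>0\}$. Modified chain: $\bar p_{xz}=p_{xz}$ if $x\notin\Gamma$; $\bar p_{xg}=1$ and $\bar p_{xz}=0$ for $z\ne g$ if $x\in\Gamma$. $\bar{\mathbb P}$ and $\bar d$ are defined as $\mathbb P$ and $d$ with $\bar p$ in place of $p$. Importance sampling measure. For a path $\omega$ let $m(\omega)=\min\{i:\omega(i)\notin\Lambda\text{ or }\omega(i)=g\}$ ($=\infty$ if there is no such $i$). Then $\mathbb Q(\omega)=\prod_{i=0}^{n_\omega-1}q_{\omega(i)\omega(i+1)}$, where $q_{\omega(i)\omega(i+1)}=\bar p_{\omega(i)\omega(i+1)}v(\omega(i+1))\big/\sum_{z\in\mathcal X}\bar p_{\omega(i)z}v(z)$ if $i<m(\omega)$, and $q_{\omega(i)\omega(i+1)}=p_{\omega(i)\omega(i+1)}$ if $i\ge m(\omega)$. (A path entering, before $m(\omega)$, a state where the denominator vanishes has $\mathbb Q(\omega)=0$.) A random path is drawn under $\mathbb Q$ from $s$ until it first hits $g$ or $t$; $\mathbf 1_\Phi$ indicates that it hits $g$; $L_{\mathbb Q}(\omega)=\mathbb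 P(\omega)/\mathbb Q(\omega)$. Expectation and variance under $\mathbb Q$ refer to this random path; e.g. $\mathbb E_{\mathbb Q}(L_{\mathbb Q}^k\mathbf 1_\Phi)=\sum_{\omega\in\Phi,\ \mathbb Q(\omega)>0}\mathbb Q(\omega)(\mathbb P(\omega)/\mathbb Q(\omega))^k$. Standing assumptions. $\Lambda$ and $\Gamma$ are finite; $d(s,g)<\infty$; under $\mathbb P$ the chain from $s$ reaches $\{t,g\}$ in finite time with probability 1; the chain has no high-probability cycle, i.e. no path with $n_\omega\ge1$, $\omega(n_\omega)=\omega(0)$ and $\mathbb P(\omega)=\Theta(\epsilon^0)$, other than the self-loops at the absorbing states $g,t$. *)

theory Defs
  imports "HOL-Probability.Probability" "HOL-Library.Extended_Nat"
begin

section \<open>Asymptotics for vanishing parameter\<close>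

text \<open>
  These notions demand that the quotient converges, so they are stronger than
  the Landau symbols of the library.
\<close>

definition is_Theta :: "(real \<Rightarrow> real) \<Rightarrow> (real \<Rightarrow> real) \<Rightarrow> bool" where
  "is_Theta f h \<longleftrightarrow> (\<exists>c>0. ((\<lambda>\<epsilon>. f \<epsilon> / h \<epsilon>) \<longlongrightarrow> c) (at_right 0))"

definition is_bigO :: "(real \<Rightarrow> real) \<Rightarrow> (real \<Rightarrow> real) \<Rightarrow> bool" where
  "is_bigO f h \<longleftrightarrow> (\<exists>c. ((\<lambda>\<epsilon>. f \<epsilon> / h \<epsilon>) \<longlongrightarrow> c) (at_right 0))"

text \<open>
  Uniform order of magnitude of a family. For an infinite exponent the
  function has to vanish for all small parameters, and the bounds do not apply.
\<close>

definition Theta_powers_uniformly :: "(real \<Rightarrow> 'a \<Rightarrow> real) \<Rightarrow> ('a \<Rightarrow> enat) \<Rightarrow> bool" where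
  "Theta_powers_uniformly f e \<longleftrightarrow>
     (\<exists>a>0. \<exists>b>0. \<forall>y.
        (case e y of
           enat n \<Rightarrow> \<exists>l. ((\<lambda>\<epsilon>. f \<epsilon> y / \<epsilon> ^ n) \<longlongrightarrow> l) (at_right 0) \<and> a < l \<and> l < b
         | \<infinity> \<Rightarrow> \<forall>\<^sub>F \<epsilon> in at_right 0. f \<epsilon> y = 0))"

section \<open>Paths and distances\<close>

text \<open>
  A path with \<open>n\<close> steps is a list of length \<open>n + 1\<close>. A transition kernel
  \<open>p\<close> takes the parameter as its first argument.
\<close>

type_synonym 'a kernel = "real \<Rightarrow> 'a \<Rightarrow> 'a \<Rightarrow> real"

definition path_prob :: "'a kernel \<Rightarrow> real \<Rightarrow> 'a list \<Rightarrow> real" where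
  "path_prob p \<epsilon> \<omega> = (\<Prod>i<length \<omega> - 1. p \<epsilon> (\<omega> ! i) (\<omega> ! Suc i))"

definition paths_between :: "'a \<Rightarrow> 'a \<Rightarrow> 'a \<Rightarrow> 'a \<Rightarrow> 'a list set" where
  "paths_between g t x z =
     {\<omega>. \<omega> \<noteq> [] \<and> hd \<omega> = x \<and> last \<omega> = z \<and> (\<forall>k<length \<omega> - 1. \<omega> ! k \<notin> {t, g})}"

text \<open>On \<open>enat\<close>, the infimum of the empty set is \<open>\<infinity>\<close>.\<close>

definition rate_dist :: "'a kernel \<Rightarrow> 'a \<Rightarrow> 'a \<Rightarrow> 'a \<Rightarrow> 'a \<Rightarrow> enat" where
  "rate_dist p g t x z =
     Inf {enat n | n. \<exists>\<omega>\<in>paths_between g t x z. is_Theta (\<lambda>\<epsilon>. path_prob p \<epsilon> \<omega>) (\<lambda>\<epsilon>. \<epsilon> ^ n)}"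

definition Lambda_set :: "'a kernel \<Rightarrow> 'a \<Rightarrow> 'a \<Rightarrow> 'a \<Rightarrow> 'a set" where
  "Lambda_set p s g t = {x. rate_dist p g t s x \<le> rate_dist p g t s g}"

text \<open>
  Positivity of a transition probability does not depend on the parameter in
  the chains considered below, so it may be tested for small parameters.
\<close>

definition Gamma_set :: "'a kernel \<Rightarrow> 'a \<Rightarrow> 'a \<Rightarrow> 'a \<Rightarrow> 'a set" where
  "Gamma_set p s g t =
     {x. x \<notin> Lambda_set p s g t \<and>
         (\<exists>z\<in>Lambda_set p s g t. \<forall>\<^sub>F \<epsilon> in at_right 0. p \<epsilon> z x > 0)}"

definition modified :: "'a kernel \<Rightarrow> 'a \<Rightarrow> 'a \<Rightarrow> 'a \<Rightarrow> 'a kernel" where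
  "modified p s g t \<epsilon> x z =
     (if x \<in> Gamma_set p s g t then (if z = g then 1 else 0) else p \<epsilon> x z)"

section \<open>The Markov chain\<close>

text \<open>
  The parameter ranges over the interval from \<open>0\<close> to \<open>\<epsilon>\<^sub>0\<close>. The event that
  the chain from \<open>s\<close> reaches \<open>{t, g}\<close> in finite time is the disjoint union, over all
  paths that start in \<open>s\<close> and stop at their first visit to \<open>{t, g}\<close>, of the events that
  the chain follows that path. In \<open>no_cycle\<close>, the exempted cycles are the
  iterated self-loops at \<open>g\<close> and \<open>t\<close>.
\<close>

locale rare_event_chain =
  fixes \<epsilon>\<^sub>0 :: real
    and p :: "real \<Rightarrow> 'a::countable \<Rightarrow> 'a \<Rightarrow> real"
    and r :: "'a \<Rightarrow> 'a \<Rightarrow> enat"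
    and s g t :: 'a
  assumes eps0_pos: "\<epsilon>\<^sub>0 > 0"
    and s_neq_g: "s \<noteq> g"
    and s_neq_t: "s \<noteq> t"
    and transitions: "\<And>x z.
          (r x z = \<infinity> \<and> (\<forall>\<epsilon>\<in>{0<..<\<epsilon>\<^sub>0}. p \<epsilon> x z = 0)) \<or>
          (\<exists>n. r x z = enat n \<and> (\<forall>\<epsilon>\<in>{0<..<\<epsilon>\<^sub>0}. p \<epsilon> x z > 0) \<and>
               is_Theta (\<lambda>\<epsilon>. p \<epsilon> x z) (\<lambda>\<epsilon>. \<epsilon> ^ n))"
    and stochastic: "\<And>\<epsilon> x. \<epsilon> \<in> {0<..<\<epsilon>\<^sub>0} \<Longrightarrow> (p \<epsilon> x has_sum 1) UNIV"
    and absorbing_g: "\<And>\<epsilon>. \<epsilon> \<in> {0<..<\<epsilon>\<^sub>0} \<Longrightarrow> p \<epsilon> g g = 1"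
    and absorbing_t: "\<And>\<epsilon>. \<epsilon> \<in> {0<..<\<epsilon>\<^sub>0} \<Longrightarrow> p \<epsilon> t t = 1"
    and finite_Lambda: "finite (Lambda_set p s g t)"
    and finite_Gamma: "finite (Gamma_set p s g t)"
    and goal_dist_finite: "rate_dist p g t s g < \<infinity>"
    and termination_as: "\<And>\<epsilon>. \<epsilon> \<in> {0<..<\<epsilon>\<^sub>0} \<Longrightarrow>
          (path_prob p \<epsilon> has_sum 1) (paths_between g t s g \<union> paths_between g t s t)"
    and no_cycle: "\<And>\<omega>. length \<omega> \<ge> 2 \<Longrightarrow> last \<omega> = hd \<omega> \<Longrightarrow>
          is_Theta (\<lambda>\<epsilon>. path_prob p \<epsilon> \<omega>) (\<lambda>\<epsilon>. \<epsilon> ^ 0) \<Longrightarrow>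
          set \<omega> = {g} \<or> set \<omega> = {t}"

section \<open>The importance sampling measure\<close>

definition exit_time :: "'a kernel \<Rightarrow> 'a \<Rightarrow> 'a \<Rightarrow> 'a \<Rightarrow> 'a list \<Rightarrow> enat" where
  "exit_time p s g t \<omega> =
     Inf {enat i | i. i < length \<omega> \<and> (\<omega> ! i \<notin> Lambda_set p s g t \<or> \<omega> ! i = g)}"

text \<open>
  Division by zero yields zero: where the denominator vanishes, the step, and
  hence the whole path, has measure zero. If \<open>x \<in> Lambda_set p s g t\<close>, which holds
  for all states visited before the exit time, the sum has only finitely many
  nonzero terms.
\<close>

definition tilted :: "'a kernel \<Rightarrow> 'a \<Rightarrow> 'a \<Rightarrow> 'a \<Rightarrow> (real \<Rightarrow> 'a \<Rightarrow> real) \<Rightarrow> 'a kernel" where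
  "tilted p s g t v \<epsilon> x y =
     modified p s g t \<epsilon> x y * v \<epsilon> y / (\<Sum>\<^sub>\<infinity>z. modified p s g t \<epsilon> x z * v \<epsilon> z)"

definition IS_prob ::
  "'a kernel \<Rightarrow> 'a \<Rightarrow> 'a \<Rightarrow> 'a \<Rightarrow> (real \<Rightarrow> 'a \<Rightarrow> real) \<Rightarrow> real \<Rightarrow> 'a list \<Rightarrow> real" where
  "IS_prob p s g t v \<epsilon> \<omega> =
     (\<Prod>i<length \<omega> - 1.
        if enat i < exit_time p s g t \<omega>
        then tilted p s g t v \<epsilon> (\<omega> ! i) (\<omega> ! Suc i)
        else p \<epsilon> (\<omega> ! i) (\<omega> ! Suc i))"

text \<open>
  The law of the random path drawn from \<open>s\<close> until it first hits \<open>g\<close> or \<open>t\<close>.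
\<close>

definition IS_measure ::
  "'a kernel \<Rightarrow> 'a \<Rightarrow> 'a \<Rightarrow> 'a \<Rightarrow> (real \<Rightarrow> 'a \<Rightarrow> real) \<Rightarrow> real \<Rightarrow> 'a list measure" where
  "IS_measure p s g t v \<epsilon> =
     point_measure (paths_between g t s g \<union> paths_between g t s t)
       (\<lambda>\<omega>. ennreal (IS_prob p s g t v \<epsilon> \<omega>))"

definition likelihood_ratio ::
  "'a kernel \<Rightarrow> 'a \<Rightarrow> 'a \<Rightarrow> 'a \<Rightarrow> (real \<Rightarrow> 'a \<Rightarrow> real) \<Rightarrow> real \<Rightarrow> 'a list \<Rightarrow> real" where
  "likelihood_ratio p s g t v \<epsilon> \<omega> = path_prob p \<epsilon> \<omega> / IS_prob p s g t v \<epsilon> \<omega>"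

definition IS_estimator ::
  "'a kernel \<Rightarrow> 'a \<Rightarrow> 'a \<Rightarrow> 'a \<Rightarrow> (real \<Rightarrow> 'a \<Rightarrow> real) \<Rightarrow> real \<Rightarrow> 'a list \<Rightarrow> real" where
  "IS_estimator p s g t v \<epsilon> \<omega> =
     likelihood_ratio p s g t v \<epsilon> \<omega> * indicator (paths_between g t s g) \<omega>"

abbreviation IS_expectation ::
  "'a kernel \<Rightarrow> 'a \<Rightarrow> 'a \<Rightarrow> 'a \<Rightarrow> (real \<Rightarrow> 'a \<Rightarrow> real) \<Rightarrow> real \<Rightarrow> ('a list \<Rightarrow> real) \<Rightarrow> real" where
  "IS_expectation p s g t v \<epsilon> \<equiv> prob_space.expectation (IS_measure p s g t v \<epsilon>)"

abbreviation IS_variance ::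
  "'a kernel \<Rightarrow> 'a \<Rightarrow> 'a \<Rightarrow> 'a \<Rightarrow> (real \<Rightarrow> 'a \<Rightarrow> real) \<Rightarrow> real \<Rightarrow> ('a list \<Rightarrow> real) \<Rightarrow> real" where
  "IS_variance p s g t v \<epsilon> X \<equiv> prob_space.variance (IS_measure p s g t v \<epsilon>) X"

definition vanishing_relative_error ::
  "'a kernel \<Rightarrow> 'a \<Rightarrow> 'a \<Rightarrow> 'a \<Rightarrow> (real \<Rightarrow> 'a \<Rightarrow> real) \<Rightarrow> bool" where
  "vanishing_relative_error p s g t v \<longleftrightarrow>
     ((\<lambda>\<epsilon>. IS_variance p s g t v \<epsilon> (IS_estimator p s g t v \<epsilon>)
           / (IS_expectation p s g t v \<epsilon> (IS_estimator p s g t v \<epsilon>))\<^sup>2) \<longlongrightarrow> 0) (at_right 0)"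

end

theory Submission
  imports Defs
begin

text \<open>
  Let \<open>d = d(s,g)\<close>, which is also the modified distance from \<open>s\<close>. On the finite set of states
  visited before the exit from \<open>\<Lambda>\<close>, the tilted transition probabilities converge, and the edges
  with positive limit form an acyclic graph because there are no high-probability cycles. The
  likelihood ratio of a path depends only on its part up to the exit, and it telescopes to
  \<open>v(s) / v(exit)\<close> times one bounded factor per visited state, so it is of order \<open>\<epsilon>\<^sup>d\<close>. Acyclicity
  yields a superharmonic function, hence a summable bound, uniform in \<open>\<epsilon>\<close>, for the contributions of all
  exit paths, and dominated convergence applies. Exits through \<open>\<Gamma>\<close> vanish in the limit, which matters
  because the hitting probabilities of \<open>g\<close> from \<open>\<Gamma>\<close> need not converge. Thus all rescaled central
  absolute moments of order at most 3 converge, the mean has a positive limit, and without vanishing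
  relative error so does the variance.
\<close>

section \<open>Edge weights along lists\<close>

text \<open>For fixed \<epsilon> the tilted chain may cycle many times before it exits, and each
  departure from \<open>x\<close> multiplies the likelihood ratio by \<open>w x / v x\<close>, whose
  limit may exceed 1. The ratio can therefore be unbounded over paths, and the mass of the sampling
  measure alone does not control a third moment. What is needed is summability of the weights
  \<open>R ^ 3 * q\<close> over all exit paths, where \<open>R\<close> bounds these factors and 3 is
  the order of the moment. Such weights need not be substochastic. Acyclicity makes up for this: a
  function may drop by any prescribed factor along each limit edge, and the room so gained also
  covers the edges whose weight only tends to 0. The prefactor \<open>v(s) / v(exit)\<close> has
  order \<epsilon> to the power \<open>d\<close> for two reasons. The modified chain jumps from
  \<Gamma> to \<open>g\<close> at rate 0, so \<open>v\<close> has order 1 at every exit state that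
  matters. This free jump does not shorten the way from \<open>s\<close>, because a state outside
  \<Lambda> is already farther from \<open>s\<close> than \<open>g\<close> is. Moments are taken
  about a convergent centre, so that one limit statement serves twice: about 0 for the mean, then
  about the mean itself.\<close>

fun edge_prod :: "('a \<Rightarrow> 'a \<Rightarrow> 'b::comm_monoid_mult) \<Rightarrow> 'a list \<Rightarrow> 'b" where
  "edge_prod k (x # y # xs) = k x y * edge_prod k (y # xs)"
| "edge_prod k _ = 1"

fun edge_sum :: "('a \<Rightarrow> 'a \<Rightarrow> 'b::comm_monoid_add) \<Rightarrow> 'a list \<Rightarrow> 'b" where
  "edge_sum k (x # y # xs) = k x y + edge_sum k (y # xs)"
| "edge_sum k _ = 0"

lemma path_prob_eq_edge_prod: "path_prob p \<epsilon> \<omega> = edge_prod (p \<epsilon>) \<omega>"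
  unfolding path_prob_def
proof (induction \<omega> rule: induct_list012)
  case (3 x y xs)
  have "(\<Prod>i<length (x # y # xs) - 1. p \<epsilon> ((x # y # xs) ! i) ((x # y # xs) ! Suc i))
     = p \<epsilon> x y * (\<Prod>i<length (y # xs) - 1. p \<epsilon> ((y # xs) ! i) ((y # xs) ! Suc i))"
    by (simp add: prod.lessThan_Suc_shift del: prod.lessThan_Suc)
  then show ?case
    using "3.IH"(2) by simp
qed auto

text \<open>The cut state \<open>y\<close> belongs to both parts, so that every edge is counted
  exactly once.\<close>

lemma edge_prod_append:
  "edge_prod k (xs @ y # ys) = edge_prod k (xs @ [y]) * edge_prod k (y # ys)"
proof (induction xs)
  case (Cons x xs)
  then show ?case
    by (cases xs) (auto simp: mult.assoc)
qed auto

lemma edge_sum_append: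
  "edge_sum k (xs @ y # ys) = edge_sum k (xs @ [y]) + edge_sum k (y # ys)"
proof (induction xs)
  case (Cons x xs)
  then show ?case
    by (cases xs) (auto simp: add.assoc)
qed auto

lemma edge_prod_nonneg:
  fixes k :: "'a \<Rightarrow> 'a \<Rightarrow> real"
  assumes "\<And>x y. 0 \<le> k x y"
  shows "0 \<le> edge_prod k \<omega>"
  by (induction \<omega> rule: induct_list012) (auto simp: assms)

text \<open>This is the shape of \<open>IS_prob\<close> when the exit time equals
  \<open>length xs\<close>: tilted steps out of \<open>xs\<close>, original steps from
  \<open>y\<close> on.\<close>

lemma prod_switch_eq_edge_prod:
  "(\<Prod>i<length xs + length ys.
      if i < length xs then k ((xs @ y # ys) ! i) ((xs @ y # ys) ! Suc i)
      else l ((xs @ y # ys) ! i) ((xs @ y # ys) ! Suc i))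
   = edge_prod k (xs @ [y]) * edge_prod l (y # ys)" for k l :: "'a \<Rightarrow> 'a \<Rightarrow> real"
proof (induction xs)
  case Nil
  show ?case
    using path_prob_eq_edge_prod[of "\<lambda>_. l" 0 "y # ys"] by (simp add: path_prob_def)
next
  case (Cons x xs)
  have "edge_prod k ((x # xs) @ [y]) = k x ((xs @ [y]) ! 0) * edge_prod k (xs @ [y])"
    by (cases xs) auto
  moreover have "(xs @ [y]) ! 0 = (xs @ y # ys) ! 0"
    by (cases xs) auto
  ultimately show ?case
    using Cons.IH
    by (simp add: prod.lessThan_Suc_shift mult.assoc del: prod.lessThan_Suc cong: if_cong)
qed

lemma list012_cases:
  obtains "xs = []" | x where "xs = [x]" | x y ys where "xs = x # y # ys"
  by (metis list.exhaust)

section \<open>Orders of magnitude\<close>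

lemma is_Theta_mult:
  assumes "is_Theta f (\<lambda>\<epsilon>. \<epsilon> ^ m)" "is_Theta h (\<lambda>\<epsilon>. \<epsilon> ^ n)"
  shows "is_Theta (\<lambda>\<epsilon>. f \<epsilon> * h \<epsilon>) (\<lambda>\<epsilon>. \<epsilon> ^ (m + n))"
proof -
  obtain c where c: "c > 0" "((\<lambda>\<epsilon>. f \<epsilon> / \<epsilon> ^ m) \<longlongrightarrow> c) (at_right 0)"
    using assms(1) unfolding is_Theta_def by blast
  obtain d where d: "d > 0" "((\<lambda>\<epsilon>. h \<epsilon> / \<epsilon> ^ n) \<longlongrightarrow> d) (at_right 0)"
    using assms(2) unfolding is_Theta_def by blast
  have "((\<lambda>\<epsilon>. (f \<epsilon> / \<epsilon> ^ m) * (h \<epsilon> / \<epsilon> ^ n)) \<longlongrightarrow> c * d) (at_right 0)"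
    by (intro tendsto_mult c d)
  with c d show ?thesis
    unfolding is_Theta_def by (auto simp: power_add intro!: exI[of _ "c * d"])
qed

lemma tendsto_power_quotient_0:
  fixes f :: "real \<Rightarrow> real"
  assumes "((\<lambda>\<epsilon>. f \<epsilon> / \<epsilon> ^ n) \<longlongrightarrow> c) (at_right 0)" "m < n"
  shows "((\<lambda>\<epsilon>. f \<epsilon> / \<epsilon> ^ m) \<longlongrightarrow> 0) (at_right 0)"
proof -
  have "((\<lambda>\<epsilon>. f \<epsilon> / \<epsilon> ^ n * \<epsilon> ^ (n - m)) \<longlongrightarrow> c * 0 ^ (n - m)) (at_right 0)"
    by (intro tendsto_intros assms)
  moreover have "\<forall>\<^sub>F \<epsilon> in at_right 0. f \<epsilon> / \<epsilon> ^ n * \<epsilon> ^ (n - m) = f \<epsilon> / \<epsilon> ^ m"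
    using eventually_at_right_less[of "0::real"]
  proof eventually_elim
    case (elim \<epsilon>)
    then show ?case
      using assms(2) power_add[of \<epsilon> m "n - m"] by (simp add: divide_simps)
  qed
  ultimately show ?thesis
    using assms(2) by (auto simp: power_0_left elim: Lim_transform_eventually)
qed

lemma is_Theta_power_unique:
  assumes "is_Theta f (\<lambda>\<epsilon>. \<epsilon> ^ m)" "is_Theta f (\<lambda>\<epsilon>. \<epsilon> ^ n)"
  shows "m = n"
proof -
  have *: False if "is_Theta f (\<lambda>\<epsilon>. \<epsilon> ^ m)" "is_Theta f (\<lambda>\<epsilon>. \<epsilon> ^ n)" "m < n" for m n
  proof -
    from that obtain c d where "c > 0" "((\<lambda>\<epsilon>. f \<epsilon> / \<epsilon> ^ m) \<longlongrightarrow> c) (at_right 0)"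
      "((\<lambda>\<epsilon>. f \<epsilon> / \<epsilon> ^ n) \<longlongrightarrow> d) (at_right 0)"
      unfolding is_Theta_def by blast
    then show False
      using tendsto_unique[OF trivial_limit_at_right_real _ tendsto_power_quotient_0[of f n d m]]
        \<open>m < n\<close> by (metis less_irrefl)
  qed
  from assms show ?thesis
    using *[of m n] *[of n m] by (meson linorder_neqE_nat)
qed

lemma is_Theta_eventually_pos:
  assumes "is_Theta f (\<lambda>\<epsilon>. \<epsilon> ^ n)"
  shows "\<forall>\<^sub>F \<epsilon> in at_right 0. 0 < f \<epsilon>"
proof -
  obtain c where c: "c > 0" "((\<lambda>\<epsilon>. f \<epsilon> / \<epsilon> ^ n) \<longlongrightarrow> c) (at_right 0)"
    using assms unfolding is_Theta_def by blast
  have "\<forall>\<^sub>F \<epsilon> in at_right 0. 0 < f \<epsilon> / \<epsilon> ^ n"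
    using order_tendstoD(1)[OF c(2,1)] .
  then show ?thesis
    using eventually_at_right_less[of "0::real"]
    by eventually_elim (simp add: zero_less_divide_iff)
qed

text \<open>Admitting the exponent \<infinity> for functions that eventually vanish lets rates be
  added in \<open>enat\<close>, so impossible edges and infinite distances need no separate
  treatment.\<close>

definition order_of :: "(real \<Rightarrow> real) \<Rightarrow> enat \<Rightarrow> bool" where
  "order_of f e \<longleftrightarrow>
     (case e of enat n \<Rightarrow> is_Theta f (\<lambda>\<epsilon>. \<epsilon> ^ n) | \<infinity> \<Rightarrow> \<forall>\<^sub>F \<epsilon> in at_right 0. f \<epsilon> = 0)"

lemma order_of_enat [simp]: "order_of f (enat n) \<longleftrightarrow> is_Theta f (\<lambda>\<epsilon>. \<epsilon> ^ n)"
  and order_of_infinity [simp]: "order_of f \<infinity> \<longleftrightarrow> (\<forall>\<^sub>F \<epsilon> in at_right 0. f \<epsilon> = 0)"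
  by (auto simp: order_of_def)

lemma order_of_mult:
  assumes "order_of f m" "order_of h n"
  shows "order_of (\<lambda>\<epsilon>. f \<epsilon> * h \<epsilon>) (m + n)"
proof (cases m)
  case m: (enat m')
  show ?thesis
  proof (cases n)
    case (enat n')
    then show ?thesis
      using assms is_Theta_mult m by simp
  next
    case infinity
    then show ?thesis
      using assms by (simp add: eventually_mono)
  qed
next
  case infinity
  then show ?thesis
    using assms by (simp add: eventually_mono)
qed

lemma order_of_1: "order_of (\<lambda>_. 1) 0"
  by (auto simp: zero_enat_def is_Theta_def intro!: exI[of _ 1])

text \<open>Exponents are unique. This turns the asymptotic condition inside
  \<open>rate_dist\<close> into an equation for the sum of rates along a path.\<close>

lemma order_of_is_Theta_iff:
  assumes "order_of f e"
  shows "is_Theta f (\<lambda>\<epsilon>. \<epsilon> ^ n) \<longleftrightarrow> e = enat n"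
proof (cases e)
  case (enat m)
  then show ?thesis
    using assms is_Theta_power_unique by auto
next
  case infinity
  then have "((\<lambda>\<epsilon>. f \<epsilon> / \<epsilon> ^ n) \<longlongrightarrow> 0) (at_right 0)"
    using assms by (auto intro!: tendsto_eventually elim: eventually_mono)
  then have "\<not> is_Theta f (\<lambda>\<epsilon>. \<epsilon> ^ n)"
    unfolding is_Theta_def using tendsto_unique[OF trivial_limit_at_right_real] by (metis less_irrefl)
  then show ?thesis
    using infinity by simp
qed

text \<open>Dividing by a power that is at most the true exponent always leaves a limit, and the
  limit detects whether the power was the true exponent. Optimal edges are recognised in this
  way.\<close>

lemma order_of_tendsto:
  assumes "order_of f e" "enat n \<le> e"
  obtains c where "c \<ge> 0" "((\<lambda>\<epsilon>. f \<epsilon> / \<epsilon> ^ n) \<longlongrightarrow> c) (at_right 0)" "c > 0 \<longleftrightarrow> e = enat n"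
proof (cases e)
  case (enat m)
  then obtain c where c: "c > 0" "((\<lambda>\<epsilon>. f \<epsilon> / \<epsilon> ^ m) \<longlongrightarrow> c) (at_right 0)"
    using assms(1) by (auto simp: is_Theta_def)
  show ?thesis
  proof (cases "m = n")
    case True
    then show ?thesis
      using that[of c] c enat by auto
  next
    case False
    then show ?thesis
      using that[of 0] tendsto_power_quotient_0[OF c(2), of n] assms(2) enat by auto
  qed
next
  case infinity
  then have "((\<lambda>\<epsilon>. f \<epsilon> / \<epsilon> ^ n) \<longlongrightarrow> 0) (at_right 0)"
    using assms by (auto intro!: tendsto_eventually elim: eventually_mono)
  then show ?thesis
    using that[of 0] infinity by auto
qed

section \<open>Rates of paths\<close>

lemma paths_between_iff:
  "\<omega> \<in> paths_between g t x z \<longleftrightarrow>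
     \<omega> \<noteq> [] \<and> hd \<omega> = x \<and> last \<omega> = z \<and> set (butlast \<omega>) \<inter> {t, g} = {}"
proof -
  have "(\<forall>k<length \<omega> - 1. \<omega> ! k \<notin> {t, g}) \<longleftrightarrow> set (butlast \<omega>) \<inter> {t, g} = {}"
    by (auto simp: in_set_conv_nth nth_butlast disjoint_iff)
  then show ?thesis
    unfolding paths_between_def by auto
qed

lemma singleton_in_paths_between [simp]: "[x] \<in> paths_between g t y z \<longleftrightarrow> x = y \<and> x = z"
  by (auto simp: paths_between_iff)

lemma Cons_in_paths_between [simp]:
  "x # y # \<omega> \<in> paths_between g t x' z \<longleftrightarrow>
     x = x' \<and> x \<noteq> t \<and> x \<noteq> g \<and> y # \<omega> \<in> paths_between g t y z"
  by (auto simp: paths_between_iff)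

lemma Nil_notin_paths_between [simp]: "[] \<notin> paths_between g t x z"
  by (auto simp: paths_between_iff)

lemma snoc_in_paths_between:
  "\<omega> \<in> paths_between g t x y \<Longrightarrow> y \<noteq> t \<Longrightarrow> y \<noteq> g \<Longrightarrow> \<omega> @ [z] \<in> paths_between g t x z"
  by (induction \<omega> arbitrary: x rule: induct_list012) auto

text \<open>Stated for an arbitrary kernel because distances are needed both for \<open>p\<close>
  and for \<open>modified p s g t\<close>.\<close>

definition kernel_rate :: "'a kernel \<Rightarrow> ('a \<Rightarrow> 'a \<Rightarrow> enat) \<Rightarrow> bool" where
  "kernel_rate p r \<longleftrightarrow> (\<forall>x z. order_of (\<lambda>\<epsilon>. p \<epsilon> x z) (r x z))"

lemma order_of_path_prob:
  assumes "kernel_rate p r"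
  shows "order_of (\<lambda>\<epsilon>. path_prob p \<epsilon> \<omega>) (edge_sum r \<omega>)"
  unfolding path_prob_eq_edge_prod
  using assms
  by (induction \<omega> rule: induct_list012) (auto simp: kernel_rate_def order_of_1 intro!: order_of_mult)

lemma rate_dist_le:
  assumes "kernel_rate p r" "\<omega> \<in> paths_between g t x z"
  shows "rate_dist p g t x z \<le> edge_sum r \<omega>"
proof (cases "edge_sum r \<omega>")
  case (enat n)
  then have "is_Theta (\<lambda>\<epsilon>. path_prob p \<epsilon> \<omega>) (\<lambda>\<epsilon>. \<epsilon> ^ n)"
    using order_of_path_prob[OF assms(1), of \<omega>] by simp
  then show ?thesis
    unfolding rate_dist_def using enat assms(2) by (auto intro!: Inf_lower)
qed auto

text \<open>\<open>enat\<close> is well-ordered, so the infimum of a nonempty set belongs to it; the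
  set is nonempty because the infimum of the empty set would be \<infinity>.\<close>

lemma rate_dist_attained:
  assumes "kernel_rate p r" "rate_dist p g t x z = enat n"
  obtains \<omega> where "\<omega> \<in> paths_between g t x z" "edge_sum r \<omega> = enat n"
proof -
  let ?D = "{enat n | n. \<exists>\<omega>\<in>paths_between g t x z.
               is_Theta (\<lambda>\<epsilon>. path_prob p \<epsilon> \<omega>) (\<lambda>\<epsilon>. \<epsilon> ^ n)}"
  have "?D \<noteq> {}"
  proof
    assume "?D = {}"
    then have "rate_dist p g t x z = Inf {}"
      unfolding rate_dist_def by (rule arg_cong)
    then show False
      using assms(2) by (simp add: top_enat_def)
  qed
  then have "rate_dist p g t x z \<in> ?D"
    unfolding rate_dist_def by (metis (no_types, lifting) wellorder_InfI ex_in_conv)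
  then obtain \<omega> where "\<omega> \<in> paths_between g t x z"
      "is_Theta (\<lambda>\<epsilon>. path_prob p \<epsilon> \<omega>) (\<lambda>\<epsilon>. \<epsilon> ^ n)"
    using assms(2) by auto
  then show thesis
    using that order_of_is_Theta_iff[OF order_of_path_prob[OF assms(1)]] by blast
qed

lemma rate_dist_self:
  assumes "kernel_rate p r"
  shows "rate_dist p g t x x = 0"
  using rate_dist_le[OF assms, of "[x]" g t x x] by simp

text \<open>An optimal path to \<open>y\<close> is extended by one state. This is admissible only if
  \<open>y\<close> may occur before the end of a path, which excludes \<open>t\<close> and
  \<open>g\<close>.\<close>

lemma rate_dist_step_right:
  assumes "kernel_rate p r" "y \<noteq> t" "y \<noteq> g"
  shows "rate_dist p g t x z \<le> rate_dist p g t x y + r y z"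
proof (cases "rate_dist p g t x y")
  case (enat n)
  then obtain \<omega> where \<omega>: "\<omega> \<in> paths_between g t x y" "edge_sum r \<omega> = enat n"
    using rate_dist_attained[OF assms(1)] by metis
  then have eq: "\<omega> = butlast \<omega> @ [y]"
    by (metis append_butlast_last_id paths_between_iff)
  have "edge_sum r (\<omega> @ [z]) = edge_sum r \<omega> + r y z"
    using edge_sum_append[of r "butlast \<omega>" y "[z]"] eq
    by (metis add_0_right append.assoc append_Cons append_Nil edge_sum.simps(1,3))
  then show ?thesis
    using rate_dist_le[OF assms(1) snoc_in_paths_between[OF \<omega>(1) assms(2,3)], of z] \<omega>(2) enat
    by simp
qed auto

lemma rate_dist_step_left:
  assumes "kernel_rate p r" "x \<noteq> t" "x \<noteq> g"
  shows "rate_dist p g t x z \<le> r x y + rate_dist p g t y z"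
proof (cases "rate_dist p g t y z")
  case (enat n)
  then obtain \<omega> where \<omega>: "\<omega> \<in> paths_between g t y z" "edge_sum r \<omega> = enat n"
    using rate_dist_attained[OF assms(1)] by metis
  then obtain \<omega>' where \<omega>': "\<omega> = y # \<omega>'"
    by (cases \<omega>) (auto simp: paths_between_iff)
  then have "rate_dist p g t x z \<le> edge_sum r (x # \<omega>)"
    using assms \<omega> by (intro rate_dist_le) auto
  then show ?thesis
    using \<omega> \<omega>' enat by simp
qed auto

text \<open>The Bellman equation: the second state of an optimal path attains equality in
  \<open>rate_dist_step_left\<close>.\<close>

lemma rate_dist_first_step:
  assumes "kernel_rate p r" "x \<noteq> z" "rate_dist p g t x z = enat n"
  obtains y where "rate_dist p g t x z = r x y + rate_dist p g t y z"
proof -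
  obtain \<omega> where \<omega>: "\<omega> \<in> paths_between g t x z" "edge_sum r \<omega> = enat n"
    using rate_dist_attained[OF assms(1,3)] by metis
  then obtain y \<omega>' where y: "\<omega> = x # y # \<omega>'"
    using assms(2) by (cases \<omega> rule: list012_cases) auto
  then have "y # \<omega>' \<in> paths_between g t y z" "x \<noteq> t" "x \<noteq> g"
    using \<omega>(1) by auto
  then have "r x y + rate_dist p g t y z \<le> rate_dist p g t x z"
    using rate_dist_le[OF assms(1)] \<omega>(2) y assms(3) by (metis add_left_mono edge_sum.simps(1))
  then show thesis
    using that rate_dist_step_left[OF assms(1) \<open>x \<noteq> t\<close> \<open>x \<noteq> g\<close>] by (metis antisym)
qed

section \<open>Dominated convergence of infinite sums\<close>

text \<open>By the Weierstrass test the finite partial sums converge uniformly in the index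
  \<open>i\<close>, and a uniform limit may be interchanged with the limit along
  \<open>F\<close>.\<close>

lemma infsum_dominated_convergence:
  fixes f :: "'i \<Rightarrow> 'x \<Rightarrow> real"
  assumes D: "D summable_on A"
    and bound: "\<forall>\<^sub>F i in F. \<forall>x\<in>A. \<bar>f i x\<bar> \<le> D x"
    and lim: "\<And>x. x \<in> A \<Longrightarrow> ((\<lambda>i. f i x) \<longlongrightarrow> l x) F"
    and F: "F \<noteq> bot"
  shows "((\<lambda>i. infsum (f i) A) \<longlongrightarrow> infsum l A) F"
proof -
  define B where "B = {i. \<forall>x\<in>A. \<bar>f i x\<bar> \<le> D x}"
  \<comment> \<open>The Weierstrass test asks for the bound at every index, whereas it holds only
    eventually; the family is set to 0 at the other indices.\<close>
  define h where "h x i = (if i \<in> B then f i x else 0)" for x i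
  have hD: "norm (h x i) \<le> D x" if "x \<in> A" for x i
  proof -
    have "0 \<le> D x"
      using eventually_happens'[OF F bound] that by fastforce
    then show ?thesis
      using that by (auto simp: h_def B_def)
  qed
  have B: "\<forall>\<^sub>F i in F. i \<in> B"
    using bound by (simp add: B_def)
  have hlim: "((\<lambda>i. h x i) \<longlongrightarrow> l x) F" if "x \<in> A" for x
    by (rule Lim_transform_eventually[OF lim[OF that]])
       (use B in eventually_elim, simp add: h_def)
  have unif: "uniform_limit UNIV (\<lambda>X i. \<Sum>x\<in>X. h x i) (\<lambda>i. infsum (\<lambda>x. h x i) A)
                (finite_subsets_at_top A)"
    by (rule Weierstrass_m_test_general[OF _ D]) (use hD in auto)
  have fin: "\<forall>\<^sub>F X in finite_subsets_at_top A. ((\<lambda>i. \<Sum>x\<in>X. h x i) \<longlongrightarrow> (\<Sum>x\<in>X. l x)) F"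
    by (intro eventually_finite_subsets_at_top_weakI tendsto_sum hlim) auto
  have "l summable_on A"
  proof -
    have "\<bar>l x\<bar> \<le> D x" if "x \<in> A" for x
      using tendsto_rabs[OF hlim[OF that]] hD[OF that] F
      by (intro tendsto_upperbound) auto
    then have "(\<lambda>x. \<bar>l x\<bar>) summable_on A"
      by (intro summable_on_comparison_test[OF D]) auto
    then show ?thesis
      using summable_on_iff_abs_summable_on_real by (simp add: abs_summable_summable)
  qed
  then have inf: "(sum l \<longlongrightarrow> infsum l A) (finite_subsets_at_top A)"
    using has_sum_infsum unfolding has_sum_def by blast
  have "((\<lambda>i. infsum (\<lambda>x. h x i) A) \<longlongrightarrow> infsum l A) F"
    by (rule swap_uniform_limit'[OF fin inf unif]) auto
  then show ?thesis
    by (rule Lim_transform_eventually) (use B in eventually_elim, simp add: h_def)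
qed

section \<open>The modified chain\<close>

locale importance_sampling = rare_event_chain \<epsilon>\<^sub>0 p r s g t
  for \<epsilon>\<^sub>0 :: real
    and p :: "real \<Rightarrow> 'a::countable \<Rightarrow> 'a \<Rightarrow> real"
    and r :: "'a \<Rightarrow> 'a \<Rightarrow> enat"
    and s g t :: 'a +
  fixes v :: "real \<Rightarrow> 'a \<Rightarrow> real"
  assumes v_nonneg: "\<epsilon> \<in> {0<..<\<epsilon>\<^sub>0} \<Longrightarrow> 0 \<le> v \<epsilon> x"
    and v_Theta: "Theta_powers_uniformly v (\<lambda>x. rate_dist (modified p s g t) g t x g)"
begin

abbreviation dist_s :: "'a \<Rightarrow> enat" where
  "dist_s x \<equiv> rate_dist p g t s x"

abbreviation \<Lambda> :: "'a set" where
  "\<Lambda> \<equiv> Lambda_set p s g t"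

abbreviation \<Gamma> :: "'a set" where
  "\<Gamma> \<equiv> Gamma_set p s g t"

abbreviation dist_g :: "'a \<Rightarrow> enat" where
  "dist_g x \<equiv> rate_dist (modified p s g t) g t x g"

definition mod_rate :: "'a \<Rightarrow> 'a \<Rightarrow> enat" where
  "mod_rate x z = (if x \<in> \<Gamma> then if z = g then 0 else \<infinity> else r x z)"

text \<open>
  The states that the tilted chain visits up to its exit from \<open>\<Lambda> - {g}\<close>, split according
  to whether the exit is still to come.
\<close>

definition live :: "'a set" where
  "live = {x \<in> \<Lambda> \<union> \<Gamma>. dist_g x \<noteq> \<infinity>}"

definition inner :: "'a set" where
  "inner = live \<inter> \<Lambda> - {g}"

definition outer :: "'a set" where
  "outer = live - inner"

abbreviation q :: "'a kernel" where
  "q \<equiv> tilted p s g t v"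

text \<open>The normalising denominator in \<open>tilted\<close>. On \<open>inner\<close> it turns
  out to have the same order as \<open>v\<close>.\<close>

definition w :: "real \<Rightarrow> 'a \<Rightarrow> real" where
  "w \<epsilon> x = (\<Sum>\<^sub>\<infinity>z. modified p s g t \<epsilon> x z * v \<epsilon> z)"

lemma eventually_small: "\<forall>\<^sub>F \<epsilon> in at_right 0. \<epsilon> \<in> {0<..<\<epsilon>\<^sub>0}"
  by (rule eventually_at_right_real[OF eps0_pos])

lemma p_nonneg: "\<epsilon> \<in> {0<..<\<epsilon>\<^sub>0} \<Longrightarrow> 0 \<le> p \<epsilon> x z"
  using transitions[of x z] by (auto simp: less_imp_le)

lemma p_pos: "\<epsilon> \<in> {0<..<\<epsilon>\<^sub>0} \<Longrightarrow> r x z \<noteq> \<infinity> \<Longrightarrow> 0 < p \<epsilon> x z"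
  using transitions[of x z] by auto

lemma p_zero: "\<epsilon> \<in> {0<..<\<epsilon>\<^sub>0} \<Longrightarrow> r x z = \<infinity> \<Longrightarrow> p \<epsilon> x z = 0"
  using transitions[of x z] by auto

lemma modified_nonneg: "\<epsilon> \<in> {0<..<\<epsilon>\<^sub>0} \<Longrightarrow> 0 \<le> modified p s g t \<epsilon> x z"
  using p_nonneg by (auto simp: modified_def)

lemma q_nonneg: "\<epsilon> \<in> {0<..<\<epsilon>\<^sub>0} \<Longrightarrow> 0 \<le> q \<epsilon> x z"
  unfolding tilted_def
  by (intro divide_nonneg_nonneg mult_nonneg_nonneg infsum_nonneg modified_nonneg v_nonneg)

lemma kernel_rate_p: "kernel_rate p r"
  unfolding kernel_rate_def
proof (intro allI)
  fix x z
  show "order_of (\<lambda>\<epsilon>. p \<epsilon> x z) (r x z)"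
  proof (cases "r x z")
    case (enat n)
    then show ?thesis
      using transitions[of x z] by auto
  next
    case infinity
    then show ?thesis
      using eventually_small by (auto elim!: eventually_mono intro: p_zero)
  qed
qed

lemma kernel_rate_modified: "kernel_rate (modified p s g t) mod_rate"
  unfolding kernel_rate_def
proof (intro allI)
  fix x z
  have "order_of (\<lambda>\<epsilon>. p \<epsilon> x z) (r x z)"
    using kernel_rate_p by (simp add: kernel_rate_def)
  then show "order_of (\<lambda>\<epsilon>. modified p s g t \<epsilon> x z) (mod_rate x z)"
    using order_of_1 by (auto simp: modified_def mod_rate_def)
qed

lemma s_in_Lambda: "s \<in> \<Lambda>"
  unfolding Lambda_set_def using rate_dist_self[OF kernel_rate_p] by simp

lemma g_in_Lambda: "g \<in> \<Lambda>"
  unfolding Lambda_set_def by simp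

lemma Lambda_Gamma_disjoint: "x \<in> \<Lambda> \<Longrightarrow> x \<notin> \<Gamma>"
  unfolding Gamma_set_def by simp

text \<open>This confines all steps out of \<Lambda> to the finite set
  \<open>\<Lambda> \<union> \<Gamma>\<close>, which makes the infinite sum in the denominator
  finite.\<close>

lemma successor_of_Lambda:
  assumes "x \<in> \<Lambda>" "r x z \<noteq> \<infinity>"
  shows "z \<in> \<Lambda> \<union> \<Gamma>"
proof -
  have "\<forall>\<^sub>F \<epsilon> in at_right 0. p \<epsilon> x z > 0"
    using eventually_small by eventually_elim (use assms(2) p_pos in blast)
  then show ?thesis
    using assms(1) unfolding Gamma_set_def by blast
qed

lemma dist_g_g: "dist_g g = 0"
  by (rule rate_dist_self[OF kernel_rate_modified])

text \<open>A path from \<open>t\<close> to another state would have \<open>t\<close> before its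
  end, which \<open>paths_between\<close> forbids.\<close>

lemma dist_g_t:
  assumes "t \<noteq> g"
  shows "dist_g t = \<infinity>"
proof (cases "dist_g t")
  case (enat n)
  then obtain \<omega> where "\<omega> \<in> paths_between g t t g"
    using rate_dist_attained[OF kernel_rate_modified] by metis
  then show ?thesis
    using assms by (cases \<omega> rule: list012_cases) auto
qed

lemma outer_cases: "y \<in> outer \<longleftrightarrow> y = g \<or> y \<in> \<Gamma> \<and> dist_g y \<noteq> \<infinity>"
  using dist_g_g g_in_Lambda Lambda_Gamma_disjoint
  by (auto simp: outer_def inner_def live_def zero_enat_def)

text \<open>From \<Gamma> the modified chain jumps to \<open>g\<close> with probability 1. The taboo
  state might lie in \<Gamma>, but its distance is infinite, so it is not in
  \<open>outer\<close>.\<close>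

lemma dist_g_outer:
  assumes "y \<in> outer"
  shows "dist_g y = 0"
proof (cases "y = g")
  case False
  with assms have "y \<in> \<Gamma>" "y \<noteq> t"
    using dist_g_t outer_cases by auto
  then show ?thesis
    using rate_dist_step_left[OF kernel_rate_modified, of y t g g g] False dist_g_g
    by (simp add: mod_rate_def)
qed (simp add: dist_g_g)

lemma innerD:
  assumes "x \<in> inner"
  shows "x \<in> live" "x \<in> \<Lambda>" "x \<noteq> g" "x \<noteq> t" "x \<notin> \<Gamma>" "dist_g x \<noteq> \<infinity>"
  using assms dist_g_t Lambda_Gamma_disjoint by (auto simp: inner_def live_def)

lemma finite_live: "finite live"
  using finite_Lambda finite_Gamma unfolding live_def by simp

lemma finite_inner: "finite inner"
  using finite_live unfolding inner_def by simp

text \<open>Every state on an optimal path from \<open>s\<close> to \<open>g\<close> is at most as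
  far from \<open>s\<close> as \<open>g\<close> is, hence lies in \<Lambda>, where the two kernels
  agree. The premise expresses that \<open>\<omega>\<close> completes such a path, in a form that
  survives the removal of the first edge.\<close>

lemma dist_le_via_optimal_path:
  assumes "\<omega> \<in> paths_between g t x g" "dist_s x + edge_sum r \<omega> \<le> dist_s g"
  shows "set \<omega> \<subseteq> live \<inter> \<Lambda> \<and> dist_g x \<le> edge_sum r \<omega>"
  using assms
proof (induction \<omega> arbitrary: x rule: induct_list012)
  case (2 y)
  then show ?case
    using g_in_Lambda dist_g_g by (auto simp: live_def zero_enat_def)
next
  case (3 x' y \<omega>)
  have x: "x' = x" "x \<noteq> t" "x \<noteq> g" and path: "y # \<omega> \<in> paths_between g t y g"
    using "3.prems"(1) by auto
  have "dist_s y + edge_sum r (y # \<omega>) \<le> dist_s x + r x y + edge_sum r (y # \<omega>)"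
    by (intro add_right_mono rate_dist_step_right[OF kernel_rate_p x(2,3)])
  also have "\<dots> \<le> dist_s g"
    using "3.prems"(2) x(1) by (simp add: add.assoc)
  finally have IH: "set (y # \<omega>) \<subseteq> live \<inter> \<Lambda>" "dist_g y \<le> edge_sum r (y # \<omega>)"
    using "3.IH"(2)[OF path] by auto
  have "dist_s x \<le> dist_s x + edge_sum r (x' # y # \<omega>)"
    by simp
  also have "\<dots> \<le> dist_s g"
    by (rule "3.prems"(2))
  finally have "x \<in> \<Lambda>"
    by (simp add: Lambda_set_def)
  then have "dist_g x \<le> r x y + dist_g y"
    using rate_dist_step_left[OF kernel_rate_modified x(2,3), of g y] Lambda_Gamma_disjoint
    by (simp add: mod_rate_def)
  also have "\<dots> \<le> edge_sum r (x' # y # \<omega>)"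
    using IH(2) x(1) by (simp add: add_left_mono)
  finally have D: "dist_g x \<le> edge_sum r (x' # y # \<omega>)" .
  have "edge_sum r (x' # y # \<omega>) \<le> dist_s x + edge_sum r (x' # y # \<omega>)"
    by (intro add_increasing) auto
  also have "\<dots> \<le> dist_s g"
    by (rule "3.prems"(2))
  also have "\<dots> < \<infinity>"
    by (rule goal_dist_finite)
  finally have "edge_sum r (x' # y # \<omega>) < \<infinity>" .
  with D have "dist_g x \<noteq> \<infinity>"
    by (metis leD)
  with \<open>x \<in> \<Lambda>\<close> IH(1) D show ?case
    using x(1) by (auto simp: live_def)
qed auto

text \<open>Inside \<Lambda> the rates agree and the triangle inequality applies. Once \<Lambda> has
  been left, the distance already spent exceeds \<open>dist_s g\<close>, so the free jump to
  \<open>g\<close> comes too late to help.\<close>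

lemma dist_s_g_le:
  assumes "\<omega> \<in> paths_between g t x g" "x \<in> \<Lambda> \<union> \<Gamma>"
  shows "dist_s g \<le> dist_s x + edge_sum mod_rate \<omega>"
  using assms
proof (induction \<omega> arbitrary: x rule: induct_list012)
  case (3 x' y \<omega>)
  have x: "x' = x" "x \<noteq> t" "x \<noteq> g" and path: "y # \<omega> \<in> paths_between g t y g"
    using "3.prems"(1) by auto
  show ?case
  proof (cases "x \<in> \<Lambda> \<and> r x y \<noteq> \<infinity>")
    case True
    then have "dist_s g \<le> dist_s y + edge_sum mod_rate (y # \<omega>)"
      using "3.IH"(2)[OF path] successor_of_Lambda by blast
    also have "\<dots> \<le> dist_s x + r x y + edge_sum mod_rate (y # \<omega>)"
      by (intro add_right_mono rate_dist_step_right[OF kernel_rate_p x(2,3)])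
    also have "\<dots> = dist_s x + edge_sum mod_rate (x' # y # \<omega>)"
      using True x(1) Lambda_Gamma_disjoint by (simp add: mod_rate_def add.assoc)
    finally show ?thesis .
  next
    case False
    show ?thesis
    proof (cases "x \<in> \<Lambda>")
      case True
      then show ?thesis
        using False x(1) Lambda_Gamma_disjoint by (simp add: mod_rate_def)
    next
      case False
      then have "dist_s g \<le> dist_s x"
        by (simp add: Lambda_set_def)
      then show ?thesis
        by (rule order_trans) simp
    qed
  qed
qed auto

lemma dist_g_s: "dist_g s = dist_s g"
  and optimal_path: "\<exists>\<omega>\<in>paths_between g t s g. edge_sum r \<omega> = dist_s g \<and> set \<omega> \<subseteq> live \<inter> \<Lambda>"
proof -
  obtain n where n: "dist_s g = enat n"
    using goal_dist_finite by (cases "dist_s g") auto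
  obtain \<omega> where \<omega>: "\<omega> \<in> paths_between g t s g" "edge_sum r \<omega> = enat n"
    using rate_dist_attained[OF kernel_rate_p n] by metis
  then have *: "set \<omega> \<subseteq> live \<inter> \<Lambda> \<and> dist_g s \<le> edge_sum r \<omega>"
    using rate_dist_self[OF kernel_rate_p, of g t s] n
    by (intro dist_le_via_optimal_path) auto
  then show "\<exists>\<omega>\<in>paths_between g t s g. edge_sum r \<omega> = dist_s g \<and> set \<omega> \<subseteq> live \<inter> \<Lambda>"
    using \<omega> n by auto
  obtain m where m: "dist_g s = enat m"
    using * \<omega>(2) by (cases "dist_g s") auto
  obtain \<omega>' where \<omega>': "\<omega>' \<in> paths_between g t s g" "edge_sum mod_rate \<omega>' = enat m"
    using rate_dist_attained[OF kernel_rate_modified m] by metis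
  then have "dist_s g \<le> dist_g s"
    using dist_s_g_le[OF \<omega>'(1)] s_in_Lambda rate_dist_self[OF kernel_rate_p, of g t s] m by simp
  with * \<omega>(2) n show "dist_g s = dist_s g"
    by simp
qed

lemma s_in_inner: "s \<in> inner"
  using s_in_Lambda s_neq_g dist_g_s goal_dist_finite by (auto simp: inner_def live_def)

section \<open>Limits of the tilted transition probabilities\<close>

lemma order_of_v: "order_of (\<lambda>\<epsilon>. v \<epsilon> x) (dist_g x)"
proof -
  obtain a b where ab: "a > 0" and *: "\<And>y. case dist_g y of
           enat n \<Rightarrow> \<exists>l. ((\<lambda>\<epsilon>. v \<epsilon> y / \<epsilon> ^ n) \<longlongrightarrow> l) (at_right 0) \<and> a < l \<and> l < b
         | \<infinity> \<Rightarrow> \<forall>\<^sub>F \<epsilon> in at_right 0. v \<epsilon> y = 0"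
    using v_Theta unfolding Theta_powers_uniformly_def by blast
  show ?thesis
  proof (cases "dist_g x")
    case (enat n)
    then show ?thesis
      using *[of x] ab by (auto simp: is_Theta_def intro: less_trans)
  next
    case infinity
    then show ?thesis
      using *[of x] by simp
  qed
qed

lemma eventually_v_pos: "\<forall>\<^sub>F \<epsilon> in at_right 0. \<forall>x\<in>live. 0 < v \<epsilon> x"
proof (intro eventually_ball_finite finite_live ballI)
  fix x assume "x \<in> live"
  then obtain n where "dist_g x = enat n"
    by (auto simp: live_def)
  then show "\<forall>\<^sub>F \<epsilon> in at_right 0. 0 < v \<epsilon> x"
    using order_of_v[of x] is_Theta_eventually_pos by simp
qed

lemma eventually_v_zero: "\<forall>\<^sub>F \<epsilon> in at_right 0. \<forall>x\<in>\<Lambda> \<union> \<Gamma> - live. v \<epsilon> x = 0"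
proof (intro eventually_ball_finite ballI)
  fix x assume "x \<in> \<Lambda> \<union> \<Gamma> - live"
  then have "dist_g x = \<infinity>"
    by (auto simp: live_def)
  then show "\<forall>\<^sub>F \<epsilon> in at_right 0. v \<epsilon> x = 0"
    using order_of_v[of x] by simp
qed (use finite_Lambda finite_Gamma in simp)

lemma modified_inner: "x \<in> inner \<Longrightarrow> modified p s g t \<epsilon> x = p \<epsilon> x"
  using innerD(5) by (auto simp: modified_def)

text \<open>A state that is not live is either unreachable in one step from \<open>x\<close>, or
  lies in \<open>\<Lambda> \<union> \<Gamma>\<close> at infinite distance from \<open>g\<close>,
  where \<open>v\<close> vanishes for small parameters. Finiteness of that union makes the threshold
  for \<epsilon> common to all states.\<close>

lemma eventually_product_zero:
  "\<forall>\<^sub>F \<epsilon> in at_right 0. \<forall>x\<in>inner. \<forall>z. z \<notin> live \<longrightarrow> p \<epsilon> x z * v \<epsilon> z = 0"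
  using eventually_v_zero eventually_small
proof eventually_elim
  case (elim \<epsilon>)
  show ?case
  proof (intro ballI allI impI)
    fix x z assume "x \<in> inner" "z \<notin> live"
    then show "p \<epsilon> x z * v \<epsilon> z = 0"
      using elim successor_of_Lambda[of x z] p_zero innerD(2)[of x]
      by (cases "r x z = \<infinity>") auto
  qed
qed

lemma eventually_w_eq_sum:
  "\<forall>\<^sub>F \<epsilon> in at_right 0. \<forall>x\<in>inner. w \<epsilon> x = (\<Sum>z\<in>live. p \<epsilon> x z * v \<epsilon> z)"
  using eventually_product_zero
proof eventually_elim
  case (elim \<epsilon>)
  show ?case
  proof
    fix x assume x: "x \<in> inner"
    have "w \<epsilon> x = (\<Sum>\<^sub>\<infinity>z\<in>live. p \<epsilon> x z * v \<epsilon> z)"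
      unfolding w_def modified_inner[OF x]
      by (intro infsum_cong_neutral) (use elim x in auto)
    then show "w \<epsilon> x = (\<Sum>z\<in>live. p \<epsilon> x z * v \<epsilon> z)"
      by (simp add: finite_live)
  qed
qed

lemma order_of_edge: "order_of (\<lambda>\<epsilon>. p \<epsilon> x z * v \<epsilon> z) (r x z + dist_g z)"
  using order_of_mult[OF _ order_of_v] kernel_rate_p unfolding kernel_rate_def by blast

lemma dist_g_le_edge: "x \<in> inner \<Longrightarrow> dist_g x \<le> r x z + dist_g z"
  using rate_dist_step_left[OF kernel_rate_modified innerD(4,3), of x g z] innerD(5)[of x]
  by (simp add: mod_rate_def)

lemma dist_g_first_step:
  assumes "x \<in> inner"
  obtains z where "z \<in> live" "dist_g x = r x z + dist_g z"
proof -
  obtain n where n: "dist_g x = enat n"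
    using innerD(6)[OF assms] by auto
  obtain z where z: "dist_g x = mod_rate x z + dist_g z"
    using rate_dist_first_step[OF kernel_rate_modified innerD(3)[OF assms] n] by metis
  then have "dist_g x = r x z + dist_g z"
    using innerD(5)[OF assms] by (simp add: mod_rate_def)
  moreover from this have "r x z \<noteq> \<infinity>" "dist_g z \<noteq> \<infinity>"
    using n by (cases "r x z"; cases "dist_g z"; simp)+
  then have "z \<in> live"
    using successor_of_Lambda[OF innerD(2)[OF assms]] by (simp add: live_def)
  ultimately show thesis
    using that by blast
qed

text \<open>By the triangle inequality each summand, divided by the power belonging to
  \<open>x\<close>, converges to a nonnegative limit; by the Bellman equation one of these limits is
  positive, and nothing can cancel.\<close>

lemma is_Theta_w:
  assumes "x \<in> inner" "dist_g x = enat n"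
  shows "is_Theta (\<lambda>\<epsilon>. w \<epsilon> x) (\<lambda>\<epsilon>. \<epsilon> ^ n)"
proof -
  have "\<forall>z. \<exists>c. c \<ge> 0 \<and> ((\<lambda>\<epsilon>. p \<epsilon> x z * v \<epsilon> z / \<epsilon> ^ n) \<longlongrightarrow> c) (at_right 0)
          \<and> (c > 0 \<longleftrightarrow> r x z + dist_g z = enat n)"
  proof
    fix z
    have "enat n \<le> r x z + dist_g z"
      using dist_g_le_edge[OF assms(1), of z] assms(2) by simp
    from order_of_tendsto[OF order_of_edge this] show "\<exists>c. c \<ge> 0 \<and>
        ((\<lambda>\<epsilon>. p \<epsilon> x z * v \<epsilon> z / \<epsilon> ^ n) \<longlongrightarrow> c) (at_right 0)
        \<and> (c > 0 \<longleftrightarrow> r x z + dist_g z = enat n)"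
      by blast
  qed
  from choice[OF this] obtain c where c: "\<And>z. c z \<ge> 0"
      "\<And>z. ((\<lambda>\<epsilon>. p \<epsilon> x z * v \<epsilon> z / \<epsilon> ^ n) \<longlongrightarrow> c z) (at_right 0)"
      "\<And>z. c z > 0 \<longleftrightarrow> r x z + dist_g z = enat n"
    by blast
  obtain z where z: "z \<in> live" "dist_g x = r x z + dist_g z"
    by (rule dist_g_first_step[OF assms(1)])
  then have "c z > 0"
    using assms(2) c(3) by simp
  then have "0 < (\<Sum>z\<in>live. c z)"
    using c(1) by (intro sum_pos2[OF finite_live z(1)])
  moreover have "((\<lambda>\<epsilon>. \<Sum>z\<in>live. p \<epsilon> x z * v \<epsilon> z / \<epsilon> ^ n) \<longlongrightarrow> (\<Sum>z\<in>live. c z)) (at_right 0)"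
    by (intro tendsto_sum c)
  then have "((\<lambda>\<epsilon>. w \<epsilon> x / \<epsilon> ^ n) \<longlongrightarrow> (\<Sum>z\<in>live. c z)) (at_right 0)"
    by (rule Lim_transform_eventually)
       (use eventually_w_eq_sum in eventually_elim, use assms(1) in \<open>simp add: sum_divide_distrib\<close>)
  ultimately show ?thesis
    unfolding is_Theta_def by blast
qed

definition q0 :: "'a \<Rightarrow> 'a \<Rightarrow> real" where
  "q0 x y = Lim (at_right 0) (\<lambda>\<epsilon>. q \<epsilon> x y)"

text \<open>The factor that a departure from \<open>x\<close> leaves in the likelihood ratio after
  telescoping, in the limit. \<open>Lim\<close> is total; here and for \<open>q0\<close> the limit
  is shown to exist only for \<open>x\<close> in \<open>inner\<close>.\<close>

definition \<rho>0 :: "'a \<Rightarrow> real" where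
  "\<rho>0 x = Lim (at_right 0) (\<lambda>\<epsilon>. w \<epsilon> x / v \<epsilon> x)"

lemma q_eq: "x \<in> inner \<Longrightarrow> q \<epsilon> x y = p \<epsilon> x y * v \<epsilon> y / w \<epsilon> x"
  unfolding tilted_def w_def using modified_inner by simp

text \<open>Numerator and denominator of \<open>q\<close> are divided by the same power, the one
  given by \<open>dist_g x\<close>. The numerator survives only if the edge begins an optimal way
  from \<open>x\<close> to \<open>g\<close>.\<close>

lemma q0_properties:
  assumes "x \<in> inner"
  shows "((\<lambda>\<epsilon>. q \<epsilon> x y) \<longlongrightarrow> q0 x y) (at_right 0)" "q0 x y \<ge> 0"
    and "q0 x y \<noteq> 0 \<Longrightarrow> r x y + dist_g y = dist_g x"
proof -
  obtain n where n: "dist_g x = enat n"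
    using innerD(6)[OF assms] by auto
  obtain c where c: "c > 0" "((\<lambda>\<epsilon>. w \<epsilon> x / \<epsilon> ^ n) \<longlongrightarrow> c) (at_right 0)"
    using is_Theta_w[OF assms n] unfolding is_Theta_def by blast
  have "enat n \<le> r x y + dist_g y"
    using dist_g_le_edge[OF assms(1), of y] n by simp
  from order_of_tendsto[OF order_of_edge this] obtain b where b: "b \<ge> 0" "((\<lambda>\<epsilon>. p \<epsilon> x y * v \<epsilon> y / \<epsilon> ^ n) \<longlongrightarrow> b) (at_right 0)"
      "b > 0 \<longleftrightarrow> r x y + dist_g y = enat n"
    by blast
  have "((\<lambda>\<epsilon>. (p \<epsilon> x y * v \<epsilon> y / \<epsilon> ^ n) / (w \<epsilon> x / \<epsilon> ^ n)) \<longlongrightarrow> b / c) (at_right 0)"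
    using b c by (intro tendsto_divide) auto
  then have lim: "((\<lambda>\<epsilon>. q \<epsilon> x y) \<longlongrightarrow> b / c) (at_right 0)"
    by (rule Lim_transform_eventually)
       (use eventually_at_right_less[of "0::real"] in eventually_elim, simp add: q_eq[OF assms])
  then have "q0 x y = b / c"
    unfolding q0_def by (intro tendsto_Lim) auto
  then show "((\<lambda>\<epsilon>. q \<epsilon> x y) \<longlongrightarrow> q0 x y) (at_right 0)" "q0 x y \<ge> 0"
    "q0 x y \<noteq> 0 \<Longrightarrow> r x y + dist_g y = dist_g x"
    using lim b c n by auto
qed

lemma \<rho>0_properties:
  assumes "x \<in> inner"
  shows "((\<lambda>\<epsilon>. w \<epsilon> x / v \<epsilon> x) \<longlongrightarrow> \<rho>0 x) (at_right 0)" "\<rho>0 x > 0"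
proof -
  obtain n where n: "dist_g x = enat n"
    using innerD(6)[OF assms] by auto
  obtain c where c: "c > 0" "((\<lambda>\<epsilon>. w \<epsilon> x / \<epsilon> ^ n) \<longlongrightarrow> c) (at_right 0)"
    using is_Theta_w[OF assms n] unfolding is_Theta_def by blast
  obtain b where b: "b > 0" "((\<lambda>\<epsilon>. v \<epsilon> x / \<epsilon> ^ n) \<longlongrightarrow> b) (at_right 0)"
    using order_of_v[of x] n by (auto simp: is_Theta_def)
  have "((\<lambda>\<epsilon>. (w \<epsilon> x / \<epsilon> ^ n) / (v \<epsilon> x / \<epsilon> ^ n)) \<longlongrightarrow> c / b) (at_right 0)"
    using b c by (intro tendsto_divide) auto
  then have lim: "((\<lambda>\<epsilon>. w \<epsilon> x / v \<epsilon> x) \<longlongrightarrow> c / b) (at_right 0)"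
    by (rule Lim_transform_eventually)
       (use eventually_at_right_less[of "0::real"] in eventually_elim, simp)
  then have "\<rho>0 x = c / b"
    unfolding \<rho>0_def by (intro tendsto_Lim) auto
  then show "((\<lambda>\<epsilon>. w \<epsilon> x / v \<epsilon> x) \<longlongrightarrow> \<rho>0 x) (at_right 0)" "\<rho>0 x > 0"
    using lim b c by auto
qed

text \<open>Collects the eventual facts needed for exact identities at one fixed parameter, so that
  the algebra of path weights can be done without limits.\<close>

definition regular :: "real \<Rightarrow> bool" where
  "regular \<epsilon> \<longleftrightarrow> \<epsilon> \<in> {0<..<\<epsilon>\<^sub>0} \<and> (\<forall>x\<in>live. 0 < v \<epsilon> x) \<and> (\<forall>x\<in>inner. 0 < w \<epsilon> x) \<and>
     (\<forall>x\<in>inner. \<forall>y. y \<notin> live \<longrightarrow> q \<epsilon> x y = 0)"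

lemma eventually_regular: "\<forall>\<^sub>F \<epsilon> in at_right 0. regular \<epsilon>"
proof -
  have "\<forall>\<^sub>F \<epsilon> in at_right 0. \<forall>x\<in>inner. 0 < w \<epsilon> x"
    using is_Theta_eventually_pos is_Theta_w innerD(6)
    by (intro eventually_ball_finite finite_inner ballI) blast
  with eventually_small eventually_v_pos eventually_product_zero show ?thesis
    by eventually_elim (auto simp: regular_def q_eq)
qed

text \<open>
  Along an edge with positive limit probability, the rate equals the decrease of \<open>dist_g\<close>, so a
  cycle of such edges would be a high-probability cycle of the original chain.
\<close>

definition limit_edges :: "('a \<times> 'a) set" where
  "limit_edges = {(x, y). x \<in> inner \<and> y \<in> live \<and> q0 x y \<noteq> 0}"

lemma limit_edges_path:
  assumes "(x, y) \<in> limit_edges\<^sup>+"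
  shows "\<exists>\<omega>. length \<omega> \<ge> 2 \<and> hd \<omega> = x \<and> last \<omega> = y \<and> edge_sum r \<omega> + dist_g y = dist_g x"
  using assms
proof (induction rule: converse_trancl_induct)
  case (base x)
  then have "r x y + dist_g y = dist_g x"
    using q0_properties(3) by (auto simp: limit_edges_def)
  then show ?case
    by (intro exI[of _ "[x, y]"]) auto
next
  case (step x z)
  then obtain \<omega> where \<omega>: "length \<omega> \<ge> 2" "hd \<omega> = z" "last \<omega> = y"
      "edge_sum r \<omega> + dist_g y = dist_g z"
    by blast
  then obtain \<omega>' where "\<omega> = z # \<omega>'"
    by (cases \<omega>) auto
  moreover have "r x z + dist_g z = dist_g x"
    using step q0_properties(3) by (auto simp: limit_edges_def)
  ultimately show ?case
    using \<omega> by (intro exI[of _ "x # \<omega>"]) (auto simp: add.assoc)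
qed

lemma acyclic_limit_edges: "acyclic limit_edges"
proof (rule acyclicI, intro allI notI)
  fix x assume x: "(x, x) \<in> limit_edges\<^sup>+"
  then have inner: "x \<in> inner"
    by (auto dest!: tranclD simp: limit_edges_def)
  obtain \<omega> where \<omega>: "length \<omega> \<ge> 2" "hd \<omega> = x" "last \<omega> = x"
      "edge_sum r \<omega> + dist_g x = dist_g x"
    using limit_edges_path[OF x] by blast
  \<comment> \<open>Cancellation in \<open>enat\<close> is legitimate here because
    \<open>dist_g x\<close> is finite.\<close>
  have "edge_sum r \<omega> = 0"
    using \<omega>(4) innerD(6)[OF inner]
    by (cases "edge_sum r \<omega>"; cases "dist_g x") (auto simp: zero_enat_def)
  then have "is_Theta (\<lambda>\<epsilon>. path_prob p \<epsilon> \<omega>) (\<lambda>\<epsilon>. \<epsilon> ^ 0)"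
    using order_of_is_Theta_iff[OF order_of_path_prob[OF kernel_rate_p]]
    by (simp only: zero_enat_def)
  \<comment> \<open>The cycle passes through an inner state, so it is none of the exempted
    self-loops.\<close>
  then have "set \<omega> = {g} \<or> set \<omega> = {t}"
    using no_cycle[OF \<omega>(1)] \<omega>(2,3) by blast
  moreover have "x \<in> set \<omega>"
    using \<omega>(1,2) by (cases \<omega>) auto
  ultimately show False
    using innerD(3,4)[OF inner] by auto
qed

text \<open>A rank for the acyclic graph of limit edges. Counting the states reachable in at least
  one step replaces the length of a longest path.\<close>

definition height :: "'a \<Rightarrow> nat" where
  "height x = card {z. (x, z) \<in> limit_edges\<^sup>+}"

text \<open>Whatever \<open>y\<close> reaches, \<open>x\<close> reaches too; \<open>x\<close> also
  reaches \<open>y\<close>, which by acyclicity \<open>y\<close> does not.\<close>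

lemma height_decreases:
  assumes "x \<in> inner" "y \<in> live" "q0 x y \<noteq> 0"
  shows "height y < height x"
proof -
  have edge: "(x, y) \<in> limit_edges"
    using assms by (simp add: limit_edges_def)
  have "{z. (x, z) \<in> limit_edges\<^sup>+} \<subseteq> live"
    by (auto simp: limit_edges_def dest!: tranclD2)
  then have "finite {z. (x, z) \<in> limit_edges\<^sup>+}"
    using finite_live finite_subset by blast
  moreover have "{z. (y, z) \<in> limit_edges\<^sup>+} \<subset> {z. (x, z) \<in> limit_edges\<^sup>+}"
    using edge acyclic_limit_edges unfolding acyclic_def
    by (auto intro: trancl_into_trancl2)
  ultimately show ?thesis
    unfolding height_def by (rule psubset_card_mono)
qed

end

section \<open>Paths up to their first visit to a set\<close>

text \<open>Used for two sets: \<open>{t, g}\<close> gives the complete sample paths, and the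
  complement of \<open>inner\<close> gives their prefixes up to the end of the tilted phase.\<close>

definition exits :: "'a set \<Rightarrow> 'a \<Rightarrow> 'a list set" where
  "exits A x = {\<omega>. \<omega> \<noteq> [] \<and> hd \<omega> = x \<and> set (butlast \<omega>) \<inter> A = {} \<and> last \<omega> \<in> A}"

lemma Nil_notin_exits [simp]: "[] \<notin> exits A x"
  and singleton_in_exits [simp]: "[y] \<in> exits A x \<longleftrightarrow> y = x \<and> x \<in> A"
  and Cons_in_exits [simp]: "y # z # \<omega> \<in> exits A x \<longleftrightarrow> y = x \<and> x \<notin> A \<and> z # \<omega> \<in> exits A z"
  by (auto simp: exits_def)

lemma exits_of_member:
  assumes "x \<in> A"
  shows "exits A x = {[x]}"
proof (rule set_eqI)
  fix \<omega>
  show "\<omega> \<in> exits A x \<longleftrightarrow> \<omega> \<in> {[x]}"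
    using assms by (cases \<omega> rule: list012_cases) auto
qed

lemma paths_between_Un_eq_exits:
  "paths_between g t x g \<union> paths_between g t x t = exits {t, g} x"
  by (auto simp: exits_def paths_between_iff)

text \<open>The superharmonic maximum principle for arbitrary nonnegative weights: condition on the
  first step and induct on a bound for the lengths of the paths.\<close>

lemma sum_exits_le:
  fixes k :: "'a \<Rightarrow> 'a \<Rightarrow> real"
  assumes k: "\<And>x y. 0 \<le> k x y" and W: "\<And>x. 0 \<le> W x" "\<And>x. x \<in> A \<Longrightarrow> 1 \<le> W x"
    and superharmonic: "\<And>x Y. x \<notin> A \<Longrightarrow> finite Y \<Longrightarrow> (\<Sum>y\<in>Y. k x y * W y) \<le> W x"
    and F: "finite F" "F \<subseteq> exits A x"
  shows "(\<Sum>\<omega>\<in>F. edge_prod k \<omega>) \<le> W x"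
proof -
  have "(\<Sum>\<omega>\<in>F. edge_prod k \<omega>) \<le> W x"
    if "finite F" "F \<subseteq> exits A x" "\<And>\<omega>. \<omega> \<in> F \<Longrightarrow> length \<omega> \<le> n" for n x F
    using that
  proof (induction n arbitrary: x F)
    case 0
    then have "F = {}"
      by force
    then show ?case
      by (simp add: W)
  next
    case (Suc n)
    show ?case
    proof (cases "x \<in> A")
      case True
      then have "F \<subseteq> {[x]}"
        using Suc.prems(2) exits_of_member[OF True] by simp
      then have "F = {} \<or> F = {[x]}"
        by (simp only: subset_singleton_iff)
      then show ?thesis
        using W(1)[of x] W(2)[OF True] by (elim disjE) simp_all
    next
      case False
      have shape: "\<exists>y \<sigma>. \<omega> = x # y # \<sigma> \<and> y # \<sigma> \<in> exits A y" if "\<omega> \<in> F" for \<omega>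
        using Suc.prems(2) that False by (cases \<omega> rule: list012_cases) auto
      \<comment> \<open>All members of \<open>F\<close> start in \<open>x\<close>, so removing the
        head is injective; the tails are then grouped by their first state to apply the induction
        hypothesis.\<close>
      define G where "G = tl ` F"
      have G: "\<sigma> \<in> exits A (hd \<sigma>) \<and> length \<sigma> \<le> n" if \<sigma>: "\<sigma> \<in> G" for \<sigma>
      proof -
        obtain \<omega> where \<omega>: "\<omega> \<in> F" "\<sigma> = tl \<omega>"
          using \<sigma> by (auto simp: G_def)
        with shape[OF \<omega>(1)] Suc.prems(3)[OF \<omega>(1)] show ?thesis
          by auto
      qed
      have "finite G"
        using Suc.prems(1) by (simp add: G_def)
      have inj: "inj_on tl F"
      proof (rule inj_onI)
        fix \<omega> \<omega>' assume "\<omega> \<in> F" "\<omega>' \<in> F" "tl \<omega> = tl \<omega>'"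
        with shape[of \<omega>] shape[of \<omega>'] show "\<omega> = \<omega>'"
          by auto
      qed
      have eq: "edge_prod k \<omega> = k x (hd (tl \<omega>)) * edge_prod k (tl \<omega>)" if "\<omega> \<in> F" for \<omega>
        using shape[OF that] by auto
      have "(\<Sum>\<omega>\<in>F. edge_prod k \<omega>) = (\<Sum>\<sigma>\<in>G. k x (hd \<sigma>) * edge_prod k \<sigma>)"
        unfolding G_def by (subst sum.reindex[OF inj]) (simp add: eq)
      also have "\<dots> = (\<Sum>y\<in>hd ` G. \<Sum>\<sigma>\<in>{\<sigma>\<in>G. hd \<sigma> = y}. k x (hd \<sigma>) * edge_prod k \<sigma>)"
        using \<open>finite G\<close> by (rule sum.image_gen)
      also have "\<dots> = (\<Sum>y\<in>hd ` G. k x y * (\<Sum>\<sigma>\<in>{\<sigma>\<in>G. hd \<sigma> = y}. edge_prod k \<sigma>))"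
        by (auto simp: sum_distrib_left intro!: sum.cong)
      also have "\<dots> \<le> (\<Sum>y\<in>hd ` G. k x y * W y)"
        using \<open>finite G\<close> by (intro sum_mono mult_left_mono k Suc.IH) (auto dest: G)
      also have "\<dots> \<le> W x"
        using \<open>finite G\<close> by (intro superharmonic False) simp
      finally show ?thesis .
    qed
  qed
  from this[of F x "Max (length ` F)"] F show ?thesis
    by simp
qed

lemma exits_summable:
  fixes k :: "'a \<Rightarrow> 'a \<Rightarrow> real"
  assumes k: "\<And>x y. 0 \<le> k x y" and W: "\<And>x. 0 \<le> W x" "\<And>x. x \<in> A \<Longrightarrow> 1 \<le> W x"
    and superharmonic: "\<And>x Y. x \<notin> A \<Longrightarrow> finite Y \<Longrightarrow> (\<Sum>y\<in>Y. k x y * W y) \<le> W x"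
  shows "edge_prod k summable_on exits A x" "infsum (edge_prod k) (exits A x) \<le> W x"
proof -
  show summable: "edge_prod k summable_on exits A x"
    using sum_exits_le[OF assms] edge_prod_nonneg[OF k]
    by (intro nonneg_bdd_above_summable_on) (auto intro!: bdd_aboveI[of _ "W x"])
  show "infsum (edge_prod k) (exits A x) \<le> W x"
    using sum_exits_le[OF assms] by (intro infsum_le_finite_sums summable) auto
qed

text \<open>Each path is cut at its first visit to \<open>B\<close>, which exists because its end
  lies in \<open>A\<close>. The cut state ends \<open>\<pi>\<close> and begins
  \<open>\<sigma>\<close>, hence the \<open>butlast\<close>.\<close>

lemma exits_decomposition:
  assumes "A \<subseteq> B"
  shows "bij_betw (\<lambda>(\<pi>, \<sigma>). butlast \<pi> @ \<sigma>)
           (SIGMA \<pi>:exits B x. exits A (last \<pi>)) (exits A x)"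
proof (rule bij_betwI)
  let ?f = "\<lambda>(\<pi>, \<sigma>). butlast \<pi> @ \<sigma>"
  let ?P = "\<lambda>y. y \<notin> B"
  let ?h = "\<lambda>\<omega>. (takeWhile ?P \<omega> @ [hd (dropWhile ?P \<omega>)], dropWhile ?P \<omega>)"
  show "?f \<in> (SIGMA \<pi>:exits B x. exits A (last \<pi>)) \<rightarrow> exits A x"
  proof safe
    fix \<pi> \<sigma> assume \<pi>: "\<pi> \<in> exits B x" and \<sigma>: "\<sigma> \<in> exits A (last \<pi>)"
    then have "hd (butlast \<pi> @ \<sigma>) = x"
      by (cases \<pi> rule: list012_cases) (auto simp: exits_def)
    then show "butlast \<pi> @ \<sigma> \<in> exits A x"
      using \<pi> \<sigma> assms by (auto simp: exits_def butlast_append)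
  qed
  show "?h \<in> exits A x \<rightarrow> (SIGMA \<pi>:exits B x. exits A (last \<pi>))"
  proof
    fix \<omega> assume \<omega>: "\<omega> \<in> exits A x"
    have ne: "dropWhile ?P \<omega> \<noteq> []"
      using \<omega> assms by (auto simp: exits_def dropWhile_eq_Nil_conv dest: last_in_set)
    then have "hd (dropWhile ?P \<omega>) \<in> B"
      using hd_dropWhile[OF ne] by simp
    moreover have "hd (takeWhile ?P \<omega> @ [hd (dropWhile ?P \<omega>)]) = x"
      using \<omega> by (cases \<omega>) (auto simp: exits_def)
    ultimately have 1: "takeWhile ?P \<omega> @ [hd (dropWhile ?P \<omega>)] \<in> exits B x"
      by (auto simp: exits_def dest: set_takeWhileD)
    have last: "last (dropWhile ?P \<omega>) = last \<omega>"
      using ne last_appendR[of "dropWhile ?P \<omega>" "takeWhile ?P \<omega>"] by simp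
    have "butlast \<omega> = takeWhile ?P \<omega> @ butlast (dropWhile ?P \<omega>)"
      using butlast_append[of "takeWhile ?P \<omega>" "dropWhile ?P \<omega>"]
      unfolding takeWhile_dropWhile_id by (simp only: ne if_False)
    then have "set (butlast (dropWhile ?P \<omega>)) \<subseteq> set (butlast \<omega>)"
      by simp
    with last have 2: "dropWhile ?P \<omega> \<in> exits A (hd (dropWhile ?P \<omega>))"
      using \<omega> ne unfolding exits_def by auto
    from 1 2 show "?h \<omega> \<in> (SIGMA \<pi>:exits B x. exits A (last \<pi>))"
      by simp
  qed
  show "?h (?f y) = y" if y_in: "y \<in> (SIGMA \<pi>:exits B x. exits A (last \<pi>))" for y
  proof -
    obtain \<pi> \<sigma> where y: "y = (\<pi>, \<sigma>)" "\<pi> \<in> exits B x" "\<sigma> \<in> exits A (last \<pi>)"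
      using y_in by auto
    then obtain \<sigma>' where \<sigma>: "\<sigma> = last \<pi> # \<sigma>'"
      by (cases \<sigma>) (auto simp: exits_def)
    have B: "\<And>z. z \<in> set (butlast \<pi>) \<Longrightarrow> z \<notin> B" "last \<pi> \<in> B" "\<pi> \<noteq> []"
      using y(2) by (auto simp: exits_def)
    then have "takeWhile ?P (butlast \<pi> @ \<sigma>) = butlast \<pi>" "dropWhile ?P (butlast \<pi> @ \<sigma>) = \<sigma>"
      using \<sigma> by (simp_all add: takeWhile_append2 dropWhile_append2)
    then show ?thesis
      using y(1) \<sigma> B(3) by simp
  qed
  show "?f (?h \<omega>) = \<omega>" if "\<omega> \<in> exits A x" for \<omega>
    by simp
qed

context importance_sampling
begin

section \<open>Factorization of the importance sampling weights\<close>

lemma exits_eq_snoc: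
  assumes "\<pi> \<in> exits (- inner) s"
  obtains xs x y where "\<pi> = xs @ [x, y]" "set xs \<subseteq> inner" "x \<in> inner" "y \<notin> inner"
proof -
  have *: "\<pi> \<noteq> []" "set (butlast \<pi>) \<subseteq> inner" "last \<pi> \<notin> inner" "hd \<pi> = s"
    using assms by (auto simp: exits_def)
  then have "butlast \<pi> \<noteq> []"
    using s_in_inner by (cases \<pi> rule: list012_cases) auto
  then have "\<pi> = butlast (butlast \<pi>) @ [last (butlast \<pi>), last \<pi>]"
    using *(1) by (metis append.assoc append_Cons append_Nil append_butlast_last_id)
  moreover have "set (butlast (butlast \<pi>)) \<subseteq> inner"
    using *(2) by (meson in_set_butlastD subset_iff)
  moreover have "last (butlast \<pi>) \<in> inner"
    using *(2) \<open>butlast \<pi> \<noteq> []\<close> by (meson last_in_set subset_iff)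
  ultimately show thesis
    using that *(3) by metis
qed

text \<open>Only an inequality is available in general: \<open>inner\<close> may be left towards a
  state of \<Lambda> that is not live, and there the exit time has not yet been reached.\<close>

lemma exit_time_ge:
  assumes "set xs \<subseteq> inner"
  shows "enat (length xs) \<le> exit_time p s g t (xs @ ys)"
  unfolding exit_time_def
proof (rule Inf_greatest)
  fix j assume "j \<in> {enat i | i. i < length (xs @ ys) \<and> ((xs @ ys) ! i \<notin> \<Lambda> \<or> (xs @ ys) ! i = g)}"
  then obtain i where i: "j = enat i" "(xs @ ys) ! i \<notin> \<Lambda> \<or> (xs @ ys) ! i = g"
    by blast
  then have "(xs @ ys) ! i \<notin> inner"
    using innerD(2,3) by metis
  then have "\<not> i < length xs"
    using assms by (metis nth_append nth_mem subsetD)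
  then show "enat (length xs) \<le> j"
    using i(1) by simp
qed

lemma exit_time_eq:
  assumes "set xs \<subseteq> inner" "y \<in> outer"
  shows "exit_time p s g t (xs @ y # ys) = enat (length xs)"
proof (rule antisym[OF _ exit_time_ge[OF assms(1)]])
  have "y \<notin> \<Lambda> \<or> y = g"
    using assms(2) outer_cases Lambda_Gamma_disjoint by blast
  then show "exit_time p s g t (xs @ y # ys) \<le> enat (length xs)"
    unfolding exit_time_def by (intro Inf_lower) force
qed

lemma q_prod_zero:
  assumes "regular \<epsilon>" "\<pi> \<in> exits (- inner) s" "last \<pi> \<notin> live"
  shows "edge_prod (q \<epsilon>) \<pi> = 0"
proof -
  obtain xs x y where \<pi>: "\<pi> = xs @ [x, y]" "x \<in> inner"
    using exits_eq_snoc[OF assms(2)] by metis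
  then have "q \<epsilon> x y = 0"
    using assms(1,3) by (auto simp: regular_def)
  then show ?thesis
    unfolding \<pi>(1) by (subst edge_prod_append) simp
qed

text \<open>For a live exit state the kernel switches exactly at that state. Otherwise the switching
  time is unknown, but the step into the exit state is still tilted and has weight 0, so both sides
  vanish.\<close>

lemma IS_prob_decomposition:
  assumes "regular \<epsilon>" "\<pi> \<in> exits (- inner) s" "\<sigma> \<in> exits {t, g} (last \<pi>)"
  shows "IS_prob p s g t v \<epsilon> (butlast \<pi> @ \<sigma>) = edge_prod (q \<epsilon>) \<pi> * path_prob p \<epsilon> \<sigma>"
proof -
  obtain xs x y where \<pi>: "\<pi> = xs @ [x, y]" "set xs \<subseteq> inner" "x \<in> inner" "y \<notin> inner"
    by (rule exits_eq_snoc[OF assms(2)])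
  define zs where "zs = xs @ [x]"
  have zs: "set zs \<subseteq> inner" "butlast \<pi> = zs" "\<pi> = zs @ [y]"
    using \<pi> by (auto simp: zs_def butlast_append)
  obtain \<sigma>' where \<sigma>: "\<sigma> = y # \<sigma>'"
    using assms(3) \<pi>(1) by (cases \<sigma>) (auto simp: exits_def)
  show ?thesis
  proof (cases "y \<in> live")
    case True
    then have "exit_time p s g t (zs @ y # \<sigma>') = enat (length zs)"
      using \<pi>(4) by (intro exit_time_eq zs) (simp add: outer_def)
    then show ?thesis
      unfolding zs(2) \<sigma> IS_prob_def path_prob_eq_edge_prod
      using prod_switch_eq_edge_prod[where xs = zs and ys = \<sigma>' and y = y and k = "q \<epsilon>" and l = "p \<epsilon>"] zs(3) by simp
  next
    case False
    \<comment> \<open>Index \<open>length xs\<close> is the step from \<open>x\<close> to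
      \<open>y\<close>; being strictly below the exit time, it contributes a tilted factor.\<close>
    have "enat (length xs) < exit_time p s g t (zs @ \<sigma>)"
      using exit_time_ge[OF zs(1), of \<sigma>] unfolding zs_def
      by (metis Suc_ile_eq length_append_singleton)
    moreover have "(zs @ \<sigma>) ! length xs = x" "(zs @ \<sigma>) ! Suc (length xs) = y"
      using \<sigma> by (simp_all add: zs_def nth_append)
    moreover have "q \<epsilon> x y = 0"
      using assms(1) \<pi>(3) False by (auto simp: regular_def)
    moreover have "length xs < length (zs @ \<sigma>) - 1"
      using \<sigma> by (simp add: zs_def)
    ultimately have "IS_prob p s g t v \<epsilon> (zs @ \<sigma>) = 0"
      unfolding IS_prob_def by (intro prod_zero) (auto intro!: bexI[of _ "length xs"])
    moreover have "edge_prod (q \<epsilon>) \<pi> = 0"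
      using q_prod_zero[OF assms(1,2)] False \<pi>(1) by simp
    ultimately show ?thesis
      using zs(2) by simp
  qed
qed

text \<open>The final state is dropped because no tilted step departs from it.\<close>

definition \<rho>_prod :: "real \<Rightarrow> 'a list \<Rightarrow> real" where
  "\<rho>_prod \<epsilon> \<pi> = (\<Prod>x\<leftarrow>butlast \<pi>. w \<epsilon> x / v \<epsilon> x)"

text \<open>The factors \<open>w x / v y\<close> of the likelihood ratio telescope.\<close>

lemma p_prod_eq:
  assumes "regular \<epsilon>" "\<pi> \<in> exits (- inner) x" "last \<pi> \<in> live"
  shows "edge_prod (p \<epsilon>) \<pi> * v \<epsilon> (last \<pi>) = edge_prod (q \<epsilon>) \<pi> * v \<epsilon> x * \<rho>_prod \<epsilon> \<pi>"
  using assms(2,3)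
proof (induction \<pi> arbitrary: x rule: induct_list012)
  case (3 x' y \<pi>)
  then have x: "x' = x" "x \<in> inner" and y: "y # \<pi> \<in> exits (- inner) y"
    by auto
  have pos: "0 < v \<epsilon> x" "0 < w \<epsilon> x"
    using assms(1) x(2) innerD(1) by (auto simp: regular_def)
  have "edge_prod (p \<epsilon>) (x' # y # \<pi>) * v \<epsilon> (last (x' # y # \<pi>))
      = p \<epsilon> x y * (edge_prod (p \<epsilon>) (y # \<pi>) * v \<epsilon> (last (y # \<pi>)))"
    using x by simp
  also have "\<dots> = p \<epsilon> x y * (edge_prod (q \<epsilon>) (y # \<pi>) * v \<epsilon> y * \<rho>_prod \<epsilon> (y # \<pi>))"
    using "3.IH"(2)[OF y] "3.prems"(2) by simp
  also have "\<dots> = (p \<epsilon> x y * v \<epsilon> y) * (edge_prod (q \<epsilon>) (y # \<pi>) * \<rho>_prod \<epsilon> (y # \<pi>))"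
    by simp
  also have "p \<epsilon> x y * v \<epsilon> y = q \<epsilon> x y * v \<epsilon> x * (w \<epsilon> x / v \<epsilon> x)"
    using pos by (simp add: q_eq[OF x(2)])
  finally show ?case
    using x(1) by (simp add: \<rho>_prod_def)
qed (auto simp: \<rho>_prod_def)

definition d :: nat where
  "d = the_enat (dist_s g)"

lemma enat_d: "dist_s g = enat d" "dist_g s = enat d"
  using goal_dist_finite dist_g_s by (auto simp: d_def)

text \<open>The likelihood ratio divided by \<open>\<epsilon> ^ d\<close>, common to all sample
  paths that share the prefix \<open>\<pi>\<close>: after the exit the two measures use the same
  kernel.\<close>

definition Y :: "real \<Rightarrow> 'a list \<Rightarrow> real" where
  "Y \<epsilon> \<pi> = v \<epsilon> s / \<epsilon> ^ d / v \<epsilon> (last \<pi>) * \<rho>_prod \<epsilon> \<pi>"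

definition scaled_estimator :: "real \<Rightarrow> 'a list \<Rightarrow> real" where
  "scaled_estimator \<epsilon> \<omega> = IS_estimator p s g t v \<epsilon> \<omega> / \<epsilon> ^ d"

lemma p_prod_eq_Y:
  assumes "regular \<epsilon>" "\<pi> \<in> exits (- inner) s" "last \<pi> \<in> live"
  shows "edge_prod (p \<epsilon>) \<pi> / \<epsilon> ^ d = edge_prod (q \<epsilon>) \<pi> * Y \<epsilon> \<pi>"
proof -
  have "0 < v \<epsilon> (last \<pi>)"
    using assms by (simp add: regular_def)
  then have "edge_prod (p \<epsilon>) \<pi> = edge_prod (q \<epsilon>) \<pi> * v \<epsilon> s * \<rho>_prod \<epsilon> \<pi> / v \<epsilon> (last \<pi>)"
    using p_prod_eq[OF assms] by (metis less_irrefl nonzero_mult_div_cancel_right)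
  then show ?thesis
    by (simp add: Y_def mult_ac)
qed

lemma Y_nonneg:
  assumes "regular \<epsilon>" "\<pi> \<in> exits (- inner) s" "last \<pi> \<in> live"
  shows "0 \<le> Y \<epsilon> \<pi>"
proof -
  have "0 \<le> w \<epsilon> x / v \<epsilon> x" if "x \<in> set (butlast \<pi>)" for x
    using that assms innerD(1)[of x] by (auto simp: exits_def regular_def disjoint_iff less_imp_le)
  then have "0 \<le> \<rho>_prod \<epsilon> \<pi>"
    unfolding \<rho>_prod_def by (intro prod_list_nonneg) auto
  then show ?thesis
    using assms s_in_inner innerD(1)[of s] by (simp add: Y_def regular_def less_imp_le)
qed

text \<open>The weights of the continuation cancel in the likelihood ratio. An arbitrary
  \<open>f\<close> lets the mean and all moments be treated at once.\<close>

lemma summand_decomposition: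
  assumes "regular \<epsilon>" "\<pi> \<in> exits (- inner) s" "\<sigma> \<in> exits {t, g} (last \<pi>)"
  shows "IS_prob p s g t v \<epsilon> (butlast \<pi> @ \<sigma>) * f (scaled_estimator \<epsilon> (butlast \<pi> @ \<sigma>))
       = edge_prod (q \<epsilon>) \<pi> * (path_prob p \<epsilon> \<sigma> * f (if last \<sigma> = g then Y \<epsilon> \<pi> else 0))"
\<comment> \<open>The ratio involves a division by zero only on paths of weight 0, where the value
  of \<open>f\<close> is irrelevant.\<close>
proof (cases "edge_prod (q \<epsilon>) \<pi> = 0 \<or> path_prob p \<epsilon> \<sigma> = 0")
  case True
  then show ?thesis
    using IS_prob_decomposition[OF assms] by auto
next
  case False
  then have live: "last \<pi> \<in> live"
    using q_prod_zero[OF assms(1,2)] by blast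
  obtain \<sigma>' where \<sigma>: "\<sigma> = last \<pi> # \<sigma>'"
    using assms(3) by (cases \<sigma>) (auto simp: exits_def)
  have "\<pi> \<noteq> []"
    using assms(2) by auto
  then have "path_prob p \<epsilon> (butlast \<pi> @ \<sigma>) = edge_prod (p \<epsilon>) \<pi> * path_prob p \<epsilon> \<sigma>"
    unfolding path_prob_eq_edge_prod \<sigma> by (subst edge_prod_append) simp
  then have "likelihood_ratio p s g t v \<epsilon> (butlast \<pi> @ \<sigma>) / \<epsilon> ^ d
      = edge_prod (p \<epsilon>) \<pi> / \<epsilon> ^ d / edge_prod (q \<epsilon>) \<pi>"
    using False by (simp add: likelihood_ratio_def IS_prob_decomposition[OF assms])
  also have "\<dots> = Y \<epsilon> \<pi>"
    using False by (simp add: p_prod_eq_Y[OF assms(1,2) live])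
  finally have L: "likelihood_ratio p s g t v \<epsilon> (butlast \<pi> @ \<sigma>) / \<epsilon> ^ d = Y \<epsilon> \<pi>" .
  have "butlast \<pi> @ \<sigma> \<in> exits {t, g} s"
  proof -
    have "{t, g} \<subseteq> - inner"
      using innerD(3,4) by blast
    from bij_betwE[OF exits_decomposition[OF this, of s]] assms(2,3) show ?thesis
      by force
  qed
  then have "butlast \<pi> @ \<sigma> \<in> paths_between g t s g \<longleftrightarrow> last \<sigma> = g"
    using \<sigma> by (auto simp: exits_def paths_between_iff)
  then have "scaled_estimator \<epsilon> (butlast \<pi> @ \<sigma>) = (if last \<sigma> = g then Y \<epsilon> \<pi> else 0)"
    using L by (auto simp: scaled_estimator_def IS_estimator_def indicator_def)
  then show ?thesis
    using IS_prob_decomposition[OF assms] by simp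
qed

end

section \<open>Elementary bounds and limits for finite products\<close>

lemma edge_prod_scale:
  fixes k :: "'a \<Rightarrow> 'a \<Rightarrow> real"
  shows "edge_prod (\<lambda>x y. c * k x y) \<omega> = c ^ (length \<omega> - 1) * edge_prod k \<omega>"
  by (induction \<omega> rule: induct_list012) auto

lemma prod_list_le_power:
  fixes f :: "'a \<Rightarrow> real"
  assumes "\<And>x. x \<in> set xs \<Longrightarrow> 0 \<le> f x \<and> f x \<le> R"
  shows "(\<Prod>x\<leftarrow>xs. f x) \<le> R ^ length xs"
  using assms
proof (induction xs)
  case (Cons x xs)
  have "0 \<le> f x \<and> f x \<le> R"
    using Cons.prems by simp
  moreover have "0 \<le> (\<Prod>x\<leftarrow>xs. f x)"
    using Cons.prems by (intro prod_list_nonneg) auto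
  moreover have "(\<Prod>x\<leftarrow>xs. f x) \<le> R ^ length xs"
    using Cons by simp
  ultimately show ?case
    by (auto intro: mult_mono)
qed simp

lemma tendsto_prod_list:
  fixes f :: "'i \<Rightarrow> 'a \<Rightarrow> real"
  assumes "\<And>x. x \<in> set xs \<Longrightarrow> ((\<lambda>i. f i x) \<longlongrightarrow> l x) F"
  shows "((\<lambda>i. \<Prod>x\<leftarrow>xs. f i x) \<longlongrightarrow> (\<Prod>x\<leftarrow>xs. l x)) F"
  using assms by (induction xs) (auto intro!: tendsto_mult)

lemma eventually_bounded_finite:
  fixes f :: "'a \<Rightarrow> 'i \<Rightarrow> real"
  assumes "finite A" "\<And>x. x \<in> A \<Longrightarrow> (f x \<longlongrightarrow> l x) F"
  obtains C where "1 \<le> C" "\<forall>\<^sub>F i in F. \<forall>x\<in>A. f x i \<le> C"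
proof
  let ?C = "1 + (\<Sum>x\<in>A. \<bar>l x\<bar>)"
  show "1 \<le> ?C"
    by (simp add: sum_nonneg)
  show "\<forall>\<^sub>F i in F. \<forall>x\<in>A. f x i \<le> ?C"
  proof (intro eventually_ball_finite assms(1) ballI)
    fix x assume x: "x \<in> A"
    have "\<bar>l x\<bar> \<le> (\<Sum>x\<in>A. \<bar>l x\<bar>)"
      by (rule member_le_sum[OF x]) (use assms(1) in auto)
    then have "l x < ?C"
      by linarith
    then show "\<forall>\<^sub>F i in F. f x i \<le> ?C"
      using order_tendstoD(2)[OF assms(2)[OF x]] by (blast intro: eventually_mono less_imp_le)
  qed
qed

context importance_sampling
begin

section \<open>Domination of the tilted path weights\<close>

text \<open>
  Since \<open>height\<close> decreases along every edge that keeps a positive probability in the limit,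
  \<open>K ^ height\<close> is superharmonic for the limit weights once \<open>K\<close> is large; half of the available
  room pays for a small perturbation of all weights.
\<close>

lemma dominating_weights:
  assumes "0 \<le> M"
  obtains b W where "\<And>x y. 0 \<le> b x y" "\<And>x. 1 \<le> W x"
    "\<And>x Y. x \<in> inner \<Longrightarrow> finite Y \<Longrightarrow> (\<Sum>y\<in>Y. b x y * W y) \<le> W x"
    "\<forall>\<^sub>F \<epsilon> in at_right 0. \<forall>x\<in>inner. \<forall>y\<in>live. M * q \<epsilon> x y \<le> b x y"
proof -
  \<comment> \<open>The sum of all the nonnegative limit weights serves as a common bound for each
    of them.\<close>
  define B where "B = M * (\<Sum>x\<in>inner. \<Sum>y\<in>live. q0 x y)"
  define N where "N = real (card live)"
  \<comment> \<open>Chosen so that \<open>N * B\<close> is at most \<open>K / 2\<close>: a limit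
    edge gains a factor \<open>K\<close> in \<open>W\<close>, and there are at most \<open>N\<close>
    edges out of a state.\<close>
  define K where "K = 1 + 2 * B * N"
  define W where "W x = K ^ height x" for x
  \<comment> \<open>The perturbation costs \<open>1 / 2\<close> in total, which is at most
    \<open>W x / 2\<close> because \<open>W\<close> is at least 1.\<close>
  define \<delta> where "\<delta> = 1 / (2 * (\<Sum>y\<in>live. W y))"
  define b where "b x y = (if x \<in> inner \<and> y \<in> live then M * q0 x y + \<delta> else 0)" for x y
  have "0 \<le> (\<Sum>x\<in>inner. \<Sum>y\<in>live. q0 x y)"
    by (intro sum_nonneg q0_properties(2))
  then have B: "0 \<le> B"
    using assms by (simp add: B_def)
  have N: "0 \<le> N"
    by (simp add: N_def)
  have K: "1 \<le> K"
    using B N by (simp add: K_def)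
  have W: "1 \<le> W x" for x
    using K by (simp add: W_def one_le_power)
  then have W_nonneg: "0 \<le> W x" for x
    by (meson order_trans zero_le_one)
  have "s \<in> live"
    using s_in_inner innerD(1) by blast
  then have W_sum: "0 < (\<Sum>y\<in>live. W y)"
    using W[of s] W_nonneg by (intro sum_pos2[OF finite_live]) auto
  then have \<delta>: "0 < \<delta>"
    by (simp add: \<delta>_def)
  have q0_le: "M * q0 x y \<le> B" if "x \<in> inner" "y \<in> live" for x y
  proof -
    have "q0 x y \<le> (\<Sum>y\<in>live. q0 x y)"
      using that by (intro member_le_sum finite_live q0_properties(2)) auto
    also have "\<dots> \<le> (\<Sum>x\<in>inner. \<Sum>y\<in>live. q0 x y)"
      using that by (intro member_le_sum[of x] finite_inner sum_nonneg q0_properties(2)) auto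
    finally show ?thesis
      unfolding B_def using assms by (rule mult_left_mono)
  qed
  have limit_part: "(\<Sum>y\<in>live. M * q0 x y * W y) \<le> W x / 2" if x: "x \<in> inner" for x
  proof (cases "B = 0")
    case True
    have "M * q0 x y = 0" if "y \<in> live" for y
      using q0_le[OF x that] q0_properties(2)[OF x, of y] assms True
      by (intro antisym) (auto intro: mult_nonneg_nonneg)
    then have "(\<Sum>y\<in>live. M * q0 x y * W y) = 0"
      by (intro sum.neutral) auto
    then show ?thesis
      using W[of x] by simp
  next
    case False
    have "M * q0 x y * W y * K \<le> B * W x" if y: "y \<in> live" for y
    proof (cases "q0 x y = 0")
      case True
      then show ?thesis
        using B W[of x] by simp
    next
      case False
      then have "Suc (height y) \<le> height x"
        using height_decreases[OF x y] by simp
      then have "W y * K \<le> W x"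
        using power_increasing[OF _ K] unfolding W_def by (metis power_Suc2)
      then have "M * q0 x y * (W y * K) \<le> B * W x"
        using q0_le[OF x y] B K W[of y] by (intro mult_mono) auto
      then show ?thesis
        by (simp add: mult.assoc)
    qed
    then have "(\<Sum>y\<in>live. M * q0 x y * W y * K) \<le> N * (B * W x)"
      unfolding N_def by (intro sum_bounded_above)
    then have "(\<Sum>y\<in>live. M * q0 x y * W y) * K \<le> N * (B * W x)"
      by (simp add: sum_distrib_right)
    also have "\<dots> \<le> W x / 2 * K"
      using W[of x] by (simp add: K_def field_simps)
    finally show ?thesis
      using K by simp
  qed
  have "0 \<le> b x y" for x y
    using assms \<delta> q0_properties(2)[of x y] by (simp add: b_def)
  moreover have "(\<Sum>y\<in>Y. b x y * W y) \<le> W x" if x: "x \<in> inner" and Y: "finite Y" for x Y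
  proof -
    have "(\<Sum>y\<in>Y. b x y * W y) = (\<Sum>y\<in>Y \<inter> live. b x y * W y)"
      by (intro sum.mono_neutral_right Y) (auto simp: b_def)
    also have "\<dots> \<le> (\<Sum>y\<in>live. b x y * W y)"
      using \<open>\<And>x y. 0 \<le> b x y\<close> W_nonneg by (intro sum_mono2 finite_live mult_nonneg_nonneg) auto
    also have "\<dots> = (\<Sum>y\<in>live. M * q0 x y * W y) + \<delta> * (\<Sum>y\<in>live. W y)"
      using x by (simp add: b_def sum_distrib_left distrib_right flip: sum.distrib)
    also have "\<delta> * (\<Sum>y\<in>live. W y) = 1 / 2"
      using W_sum by (simp add: \<delta>_def)
    also have "(\<Sum>y\<in>live. M * q0 x y * W y) + 1 / 2 \<le> W x"
      using limit_part[OF x] W[of x] by linarith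
    finally show ?thesis .
  qed
  moreover have "\<forall>\<^sub>F \<epsilon> in at_right 0. \<forall>x\<in>inner. \<forall>y\<in>live. M * q \<epsilon> x y \<le> b x y"
  proof (intro eventually_ball_finite finite_inner finite_live ballI)
    fix x y assume x: "x \<in> inner" and y: "y \<in> live"
    have "((\<lambda>\<epsilon>. M * q \<epsilon> x y) \<longlongrightarrow> M * q0 x y) (at_right 0)"
      by (intro tendsto_mult_left q0_properties(1) x)
    moreover have "M * q0 x y < b x y"
      using x y \<delta> by (simp add: b_def)
    ultimately show "\<forall>\<^sub>F \<epsilon> in at_right 0. M * q \<epsilon> x y \<le> b x y"
      using order_tendstoD(2) by (fastforce elim: eventually_mono)
  qed
  ultimately show thesis
    using that W by blast
qed

text \<open>With a live end, every edge of such a path leads from \<open>inner\<close> to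
  \<open>live\<close>, so the comparison is required only there.\<close>

lemma edge_prod_mono_exits:
  fixes k b :: "'a \<Rightarrow> 'a \<Rightarrow> real"
  assumes "\<And>x y. 0 \<le> k x y" "\<And>x y. x \<in> inner \<Longrightarrow> y \<in> live \<Longrightarrow> k x y \<le> b x y"
    and "\<pi> \<in> exits (- inner) x" "last \<pi> \<in> live"
  shows "edge_prod k \<pi> \<le> edge_prod b \<pi>"
  using assms(3,4)
proof (induction \<pi> arbitrary: x rule: induct_list012)
  case (3 x' y \<pi>)
  then have x: "x' = x" "x \<in> inner" and y: "y # \<pi> \<in> exits (- inner) y"
    by auto
  have "y \<in> live"
    using y "3.prems"(2) innerD(1) by (cases \<pi>) auto
  then have "k x y \<le> b x y"
    using assms(2) x by blast
  moreover have "edge_prod k (y # \<pi>) \<le> edge_prod b (y # \<pi>)"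
    using "3.IH"(2)[OF y] "3.prems"(2) by simp
  moreover have "0 \<le> k x y" "0 \<le> edge_prod k (y # \<pi>)"
    using assms(1) edge_prod_nonneg by blast+
  ultimately show ?case
    using x(1) by (auto intro: mult_mono)
qed auto

text \<open>Each departure contributes a factor of at most \<open>R\<close>, and the prefactor is
  bounded because \<open>v\<close> has a positive limit at each of the finitely many states of
  \<open>outer\<close>. The bound may grow with the length of the prefix.\<close>

lemma Y_bound:
  obtains C R where "1 \<le> C" "1 \<le> R"
    "\<forall>\<^sub>F \<epsilon> in at_right 0. \<forall>\<pi>\<in>exits (- inner) s. last \<pi> \<in> live \<longrightarrow> Y \<epsilon> \<pi> \<le> C * R ^ (length \<pi> - 1)"
proof -
  obtain R where R: "1 \<le> R" "\<forall>\<^sub>F \<epsilon> in at_right 0. \<forall>x\<in>inner. w \<epsilon> x / v \<epsilon> x \<le> R"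
    by (rule eventually_bounded_finite[of inner "\<lambda>x \<epsilon>. w \<epsilon> x / v \<epsilon> x" \<rho>0 "at_right 0"])
       (use finite_inner \<rho>0_properties(1) in auto)
  obtain a where a: "((\<lambda>\<epsilon>. v \<epsilon> s / \<epsilon> ^ d) \<longlongrightarrow> a) (at_right 0)"
    using order_of_v[of s] enat_d(2) by (auto simp: is_Theta_def)
  have "\<forall>y. \<exists>b. y \<in> outer \<longrightarrow> ((\<lambda>\<epsilon>. v \<epsilon> y) \<longlongrightarrow> b) (at_right 0) \<and> b > 0"
  proof
    fix y
    show "\<exists>b. y \<in> outer \<longrightarrow> ((\<lambda>\<epsilon>. v \<epsilon> y) \<longlongrightarrow> b) (at_right 0) \<and> b > 0"
      using order_of_v[of y] dist_g_outer[of y] by (auto simp: is_Theta_def zero_enat_def)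
  qed
  from choice[OF this] obtain b where b: "\<And>y. y \<in> outer \<Longrightarrow> ((\<lambda>\<epsilon>. v \<epsilon> y) \<longlongrightarrow> b y) (at_right 0)"
      "\<And>y. y \<in> outer \<Longrightarrow> b y > 0"
    by blast
  have "finite outer"
    using finite_live by (simp add: outer_def)
  then obtain C where C: "1 \<le> C"
      "\<forall>\<^sub>F \<epsilon> in at_right 0. \<forall>y\<in>outer. v \<epsilon> s / \<epsilon> ^ d / v \<epsilon> y \<le> C"
  proof (rule eventually_bounded_finite)
    show "((\<lambda>\<epsilon>. v \<epsilon> s / \<epsilon> ^ d / v \<epsilon> y) \<longlongrightarrow> a / b y) (at_right 0)" if "y \<in> outer" for y
      using b(2)[OF that] by (intro tendsto_divide a b(1) that) simp
  qed blast
  have "\<forall>\<^sub>F \<epsilon> in at_right 0. \<forall>\<pi>\<in>exits (- inner) s. last \<pi> \<in> live \<longrightarrow> Y \<epsilon> \<pi> \<le> C * R ^ (length \<pi> - 1)"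
    using R(2) C(2) eventually_regular
  proof eventually_elim
    case (elim \<epsilon>)
    show ?case
    proof (intro ballI impI)
      fix \<pi> assume \<pi>: "\<pi> \<in> exits (- inner) s" "last \<pi> \<in> live"
      have ratio: "0 \<le> w \<epsilon> x / v \<epsilon> x \<and> w \<epsilon> x / v \<epsilon> x \<le> R" if "x \<in> set (butlast \<pi>)" for x
      proof -
        have "x \<in> inner"
          using that \<pi>(1) by (auto simp: exits_def)
        then show ?thesis
          using elim innerD(1)[of x] by (auto simp: regular_def less_imp_le)
      qed
      then have "\<rho>_prod \<epsilon> \<pi> \<le> R ^ (length \<pi> - 1)"
        using prod_list_le_power[of "butlast \<pi>" "\<lambda>x. w \<epsilon> x / v \<epsilon> x" R] by (simp add: \<rho>_prod_def)
      moreover have "0 \<le> \<rho>_prod \<epsilon> \<pi>"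
        unfolding \<rho>_prod_def using ratio by (intro prod_list_nonneg) auto
      moreover have "v \<epsilon> s / \<epsilon> ^ d / v \<epsilon> (last \<pi>) \<le> C"
        using elim \<pi> by (auto simp: exits_def outer_def)
      ultimately show "Y \<epsilon> \<pi> \<le> C * R ^ (length \<pi> - 1)"
        unfolding Y_def using C(1) by (intro mult_mono) auto
    qed
  qed
  then show thesis
    using that R(1) C(1) by blast
qed

section \<open>Limits of the contributions of single prefixes\<close>

text \<open>The normalisation by \<open>\<epsilon> ^ d\<close> is exactly the order of
  \<open>v\<close> at \<open>s\<close>, and \<open>v\<close> has order 1 at the exit state.\<close>

lemma Y_tendsto:
  assumes "\<pi> \<in> exits (- inner) s" "last \<pi> \<in> live"
  obtains y where "y > 0" "((\<lambda>\<epsilon>. Y \<epsilon> \<pi>) \<longlongrightarrow> y) (at_right 0)"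
proof -
  obtain a where a: "a > 0" "((\<lambda>\<epsilon>. v \<epsilon> s / \<epsilon> ^ d) \<longlongrightarrow> a) (at_right 0)"
    using order_of_v[of s] enat_d(2) by (auto simp: is_Theta_def)
  have "dist_g (last \<pi>) = 0"
    using assms by (intro dist_g_outer) (auto simp: exits_def outer_def)
  then obtain b where b: "b > 0" "((\<lambda>\<epsilon>. v \<epsilon> (last \<pi>)) \<longlongrightarrow> b) (at_right 0)"
    using order_of_v[of "last \<pi>"] by (auto simp: is_Theta_def zero_enat_def)
  have inner: "x \<in> inner" if "x \<in> set (butlast \<pi>)" for x
    using that assms(1) by (auto simp: exits_def)
  have "((\<lambda>\<epsilon>. Y \<epsilon> \<pi>) \<longlongrightarrow> a / b * (\<Prod>x\<leftarrow>butlast \<pi>. \<rho>0 x)) (at_right 0)"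
    unfolding Y_def \<rho>_prod_def using a b inner
    by (intro tendsto_mult tendsto_divide tendsto_prod_list \<rho>0_properties(1)) auto
  moreover have "0 < (\<Prod>x\<leftarrow>xs. \<rho>0 x)" if "set xs \<subseteq> inner" for xs
    using that \<rho>0_properties(2) by (induction xs) auto
  then have "0 < a / b * (\<Prod>x\<leftarrow>butlast \<pi>. \<rho>0 x)"
    using a b inner by (simp add: subsetI)
  ultimately show thesis
    using that by blast
qed

lemma q_prod_tendsto:
  assumes "\<pi> \<in> exits (- inner) x"
  shows "((\<lambda>\<epsilon>. edge_prod (q \<epsilon>) \<pi>) \<longlongrightarrow> edge_prod q0 \<pi>) (at_right 0)"
  using assms
  by (induction \<pi> arbitrary: x rule: induct_list012) (auto intro!: tendsto_mult q0_properties(1))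

text \<open>Leaving \<open>\<Lambda>\<close> costs more than the optimal path, but the likelihood ratio is always \<open>\<Theta>(\<epsilon>\<^sup>d)\<close>.\<close>

lemma q_prod_tendsto_0:
  assumes "\<pi> \<in> exits (- inner) s" "last \<pi> \<in> live" "last \<pi> \<noteq> g"
  shows "((\<lambda>\<epsilon>. edge_prod (q \<epsilon>) \<pi>) \<longlongrightarrow> 0) (at_right 0)"
proof -
  have "last \<pi> \<notin> \<Lambda>"
    using assms by (auto simp: exits_def inner_def)
  then have "enat d < dist_s (last \<pi>)"
    using enat_d(1) by (simp add: Lambda_set_def)
  also have "\<dots> \<le> edge_sum r \<pi>"
    using assms(1) innerD(3,4)
    by (intro rate_dist_le[OF kernel_rate_p]) (auto simp: exits_def paths_between_iff)
  finally have less: "enat d < edge_sum r \<pi>" .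
  obtain c where "c \<ge> 0" "((\<lambda>\<epsilon>. path_prob p \<epsilon> \<pi> / \<epsilon> ^ d) \<longlongrightarrow> c) (at_right 0)"
      "c > 0 \<longleftrightarrow> edge_sum r \<pi> = enat d"
    using order_of_tendsto[OF order_of_path_prob[OF kernel_rate_p] less_imp_le[OF less]] by blast
  moreover from this less have "c = 0"
    by auto
  ultimately have lim: "((\<lambda>\<epsilon>. edge_prod (p \<epsilon>) \<pi> / \<epsilon> ^ d) \<longlongrightarrow> 0) (at_right 0)"
    by (simp add: path_prob_eq_edge_prod)
  obtain y where y: "y > 0" "((\<lambda>\<epsilon>. Y \<epsilon> \<pi>) \<longlongrightarrow> y) (at_right 0)"
    using Y_tendsto[OF assms(1,2)] by blast
  have "((\<lambda>\<epsilon>. (edge_prod (p \<epsilon>) \<pi> / \<epsilon> ^ d) / Y \<epsilon> \<pi>) \<longlongrightarrow> 0 / y) (at_right 0)"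
    using y by (intro tendsto_divide lim) auto
  \<comment> \<open>The tilted weight is recovered from the original one by dividing out
    \<open>Y\<close>, which is eventually positive.\<close>
  moreover have "\<forall>\<^sub>F \<epsilon> in at_right 0. (edge_prod (p \<epsilon>) \<pi> / \<epsilon> ^ d) / Y \<epsilon> \<pi> = edge_prod (q \<epsilon>) \<pi>"
    using eventually_regular order_tendstoD(1)[OF y(2,1)]
  proof eventually_elim
    case (elim \<epsilon>)
    then show ?case
      using p_prod_eq_Y[OF _ assms(1,2)] by simp
  qed
  ultimately show ?thesis
    by (simp add: Lim_transform_eventually)
qed

text \<open>The moment about \<open>c\<close> contributed by all continuations of
  \<open>\<pi>\<close>, weighted with the original kernel since tilting has ended.\<close>

definition tail_moment :: "nat \<Rightarrow> real \<Rightarrow> real \<Rightarrow> 'a list \<Rightarrow> real" where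
  "tail_moment k c \<epsilon> \<pi> = (\<Sum>\<^sub>\<infinity>\<sigma>\<in>exits {t, g} (last \<pi>).
     path_prob p \<epsilon> \<sigma> * \<bar>(if last \<sigma> = g then Y \<epsilon> \<pi> else 0) - c\<bar> ^ k)"

lemma path_prob_nonneg: "\<epsilon> \<in> {0<..<\<epsilon>\<^sub>0} \<Longrightarrow> 0 \<le> path_prob p \<epsilon> \<omega>"
  unfolding path_prob_def by (intro prod_nonneg ballI p_nonneg)

text \<open>The constant function 1 is superharmonic for a stochastic kernel.\<close>

lemma path_prob_summable:
  assumes \<epsilon>: "\<epsilon> \<in> {0<..<\<epsilon>\<^sub>0}"
  shows "path_prob p \<epsilon> summable_on exits {t, g} x" "infsum (path_prob p \<epsilon>) (exits {t, g} x) \<le> 1"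
proof -
  have *: "path_prob p \<epsilon> = edge_prod (p \<epsilon>)"
    by (intro ext path_prob_eq_edge_prod)
  have "(\<Sum>y\<in>Y. p \<epsilon> x y * 1) \<le> 1" if "finite Y" for x Y
    using finite_sum_le_has_sum[OF stochastic[OF \<epsilon>] that] p_nonneg[OF \<epsilon>] by simp
  then show "path_prob p \<epsilon> summable_on exits {t, g} x"
    "infsum (path_prob p \<epsilon>) (exits {t, g} x) \<le> 1"
    unfolding * using exits_summable[of "p \<epsilon>" "\<lambda>_. 1" "{t, g}" x] p_nonneg[OF \<epsilon>] by auto
qed

text \<open>Both possible values of the estimator, \<open>Y\<close> and 0, have distance at most
  \<open>Y + \<bar>c\<bar>\<close> from \<open>c\<close>, and the continuations have total mass at
  most 1.\<close>

lemma tail_moment_bounds: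
  assumes "regular \<epsilon>" "\<pi> \<in> exits (- inner) s" "last \<pi> \<in> live"
  shows "(\<lambda>\<sigma>. path_prob p \<epsilon> \<sigma> * \<bar>(if last \<sigma> = g then Y \<epsilon> \<pi> else 0) - c\<bar> ^ k)
           summable_on exits {t, g} (last \<pi>)" (is "?f summable_on ?A")
    and "0 \<le> tail_moment k c \<epsilon> \<pi>" "tail_moment k c \<epsilon> \<pi> \<le> (Y \<epsilon> \<pi> + \<bar>c\<bar>) ^ k"
proof -
  have \<epsilon>: "\<epsilon> \<in> {0<..<\<epsilon>\<^sub>0}"
    using assms(1) by (simp add: regular_def)
  let ?B = "(Y \<epsilon> \<pi> + \<bar>c\<bar>) ^ k"
  have B: "?f \<sigma> \<le> path_prob p \<epsilon> \<sigma> * ?B" for \<sigma>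
    using Y_nonneg[OF assms] path_prob_nonneg[OF \<epsilon>] by (intro mult_left_mono power_mono) auto
  have nonneg: "0 \<le> ?f \<sigma>" for \<sigma>
    using path_prob_nonneg[OF \<epsilon>] by (intro mult_nonneg_nonneg) auto
  have sum_B: "(\<lambda>\<sigma>. path_prob p \<epsilon> \<sigma> * ?B) summable_on ?A"
    by (intro summable_on_cmult_left path_prob_summable \<epsilon>)
  show summable: "?f summable_on ?A"
    by (rule summable_on_comparison_test[OF sum_B]) (use B nonneg in auto)
  show "0 \<le> tail_moment k c \<epsilon> \<pi>"
    unfolding tail_moment_def by (intro infsum_nonneg nonneg)
  have "tail_moment k c \<epsilon> \<pi> \<le> (\<Sum>\<^sub>\<infinity>\<sigma>\<in>?A. path_prob p \<epsilon> \<sigma> * ?B)"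
    unfolding tail_moment_def by (intro infsum_mono summable sum_B B)
  also have "\<dots> = infsum (path_prob p \<epsilon>) ?A * ?B"
    by (intro infsum_cmult_left path_prob_summable \<epsilon>)
  also have "\<dots> \<le> 1 * ?B"
    using Y_nonneg[OF assms] by (intro mult_right_mono path_prob_summable \<epsilon>) auto
  finally show "tail_moment k c \<epsilon> \<pi> \<le> ?B"
    by simp
qed

lemma tail_moment_goal:
  assumes "last \<pi> = g"
  shows "tail_moment k c \<epsilon> \<pi> = \<bar>Y \<epsilon> \<pi> - c\<bar> ^ k"
  using assms exits_of_member[of g "{t, g}"] by (simp add: tail_moment_def path_prob_def)

text \<open>For a prefix ending in \<open>g\<close> the trivial continuation is the only one, and
  the limit is explicit. For an exit through \<Gamma> the tail moment is merely bounded, so it is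
  squeezed by the vanishing prefix weight.\<close>

lemma contribution_tendsto:
  assumes \<pi>: "\<pi> \<in> exits (- inner) s" and c: "(c \<longlongrightarrow> c0) (at_right 0)"
  shows "\<exists>l. ((\<lambda>\<epsilon>. edge_prod (q \<epsilon>) \<pi> * tail_moment k (c \<epsilon>) \<epsilon> \<pi>) \<longlongrightarrow> l) (at_right 0)"
proof (cases "last \<pi> \<in> live")
  case False
  then have "\<forall>\<^sub>F \<epsilon> in at_right 0. edge_prod (q \<epsilon>) \<pi> * tail_moment k (c \<epsilon>) \<epsilon> \<pi> = 0"
    using eventually_regular by (auto elim!: eventually_mono dest: q_prod_zero[OF _ \<pi>])
  then show ?thesis
    by (intro exI[of _ 0] tendsto_eventually)
next
  case live: True
  obtain y where y: "y > 0" "((\<lambda>\<epsilon>. Y \<epsilon> \<pi>) \<longlongrightarrow> y) (at_right 0)"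
    using Y_tendsto[OF \<pi> live] by blast
  show ?thesis
  proof (cases "last \<pi> = g")
    case True
    have "((\<lambda>\<epsilon>. edge_prod (q \<epsilon>) \<pi> * \<bar>Y \<epsilon> \<pi> - c \<epsilon>\<bar> ^ k)
            \<longlongrightarrow> edge_prod q0 \<pi> * \<bar>y - c0\<bar> ^ k) (at_right 0)"
      by (intro tendsto_mult q_prod_tendsto[OF \<pi>] tendsto_intros y c)
    then show ?thesis
      unfolding tail_moment_goal[OF True] by blast
  next
    case False
    have "((\<lambda>\<epsilon>. edge_prod (q \<epsilon>) \<pi> * (Y \<epsilon> \<pi> + \<bar>c \<epsilon>\<bar>) ^ k) \<longlongrightarrow> 0 * (y + \<bar>c0\<bar>) ^ k) (at_right 0)"
      by (intro tendsto_mult q_prod_tendsto_0[OF \<pi> live False] tendsto_intros y c)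
    then have upper: "((\<lambda>\<epsilon>. edge_prod (q \<epsilon>) \<pi> * (Y \<epsilon> \<pi> + \<bar>c \<epsilon>\<bar>) ^ k) \<longlongrightarrow> 0) (at_right 0)"
      by simp
    have "((\<lambda>\<epsilon>. edge_prod (q \<epsilon>) \<pi> * tail_moment k (c \<epsilon>) \<epsilon> \<pi>) \<longlongrightarrow> 0) (at_right 0)"
    proof (rule tendsto_sandwich[OF _ _ tendsto_const upper])
      show "\<forall>\<^sub>F \<epsilon> in at_right 0. 0 \<le> edge_prod (q \<epsilon>) \<pi> * tail_moment k (c \<epsilon>) \<epsilon> \<pi>"
        using eventually_regular
      proof eventually_elim
        case (elim \<epsilon>)
        then have "\<epsilon> \<in> {0<..<\<epsilon>\<^sub>0}"
          by (simp add: regular_def)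
        then show ?case
          using tail_moment_bounds(2)[OF elim \<pi> live]
          by (intro mult_nonneg_nonneg edge_prod_nonneg q_nonneg)
      qed
      show "\<forall>\<^sub>F \<epsilon> in at_right 0. edge_prod (q \<epsilon>) \<pi> * tail_moment k (c \<epsilon>) \<epsilon> \<pi>
              \<le> edge_prod (q \<epsilon>) \<pi> * (Y \<epsilon> \<pi> + \<bar>c \<epsilon>\<bar>) ^ k"
        using eventually_regular
      proof eventually_elim
        case (elim \<epsilon>)
        then have "\<epsilon> \<in> {0<..<\<epsilon>\<^sub>0}"
          by (simp add: regular_def)
        then show ?case
          using tail_moment_bounds(3)[OF elim \<pi> live]
          by (intro mult_left_mono edge_prod_nonneg q_nonneg)
      qed
    qed
    then show ?thesis
      by blast
  qed
qed

section \<open>Convergence of the rescaled moments\<close>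

text \<open>The factor \<open>R ^ m\<close> of the bound for \<open>Y\<close>, raised to the third
  power, is distributed over the \<open>m\<close> edges of the prefix; this produces the weights
  \<open>R ^ 3 * q\<close>, which \<open>dominating_weights\<close> controls.\<close>

lemma dominating_summable:
  assumes "(c \<longlongrightarrow> c0) (at_right 0)" "k \<le> 3"
  obtains D where "D summable_on exits (- inner) s"
    "\<forall>\<^sub>F \<epsilon> in at_right 0. \<forall>\<pi>\<in>exits (- inner) s.
       0 \<le> edge_prod (q \<epsilon>) \<pi> * tail_moment k (c \<epsilon>) \<epsilon> \<pi> \<and>
       edge_prod (q \<epsilon>) \<pi> * tail_moment k (c \<epsilon>) \<epsilon> \<pi> \<le> D \<pi>"
proof -
  obtain C R where CR: "1 \<le> C" "1 \<le> R"
    and Y: "\<forall>\<^sub>F \<epsilon> in at_right 0. \<forall>\<pi>\<in>exits (- inner) s.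
              last \<pi> \<in> live \<longrightarrow> Y \<epsilon> \<pi> \<le> C * R ^ (length \<pi> - 1)"
    using Y_bound by blast
  have "0 \<le> R ^ 3"
    using CR by simp
  then obtain b W where b: "\<And>x y. 0 \<le> b x y" and W: "\<And>x. 1 \<le> W x"
    and superharmonic: "\<And>x Y. x \<in> inner \<Longrightarrow> finite Y \<Longrightarrow> (\<Sum>y\<in>Y. b x y * W y) \<le> W x"
    and qb: "\<forall>\<^sub>F \<epsilon> in at_right 0. \<forall>x\<in>inner. \<forall>y\<in>live. R ^ 3 * q \<epsilon> x y \<le> b x y"
    using dominating_weights by blast
  \<comment> \<open>The summand \<open>\<bar>c0\<bar> + 1\<close> eventually bounds the moving
    centre. Bounds of at least 1 allow the exponent \<open>k\<close> to be raised to 3.\<close>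
  define C' where "C' = C + (\<bar>c0\<bar> + 1)"
  have C': "1 \<le> C'"
    using CR by (simp add: C'_def)
  have "((\<lambda>\<epsilon>. \<bar>c \<epsilon>\<bar>) \<longlongrightarrow> \<bar>c0\<bar>) (at_right 0)"
    by (intro tendsto_intros assms(1))
  then have c: "\<forall>\<^sub>F \<epsilon> in at_right 0. \<bar>c \<epsilon>\<bar> < \<bar>c0\<bar> + 1"
    by (rule order_tendstoD(2)) simp
  have "edge_prod b summable_on exits (- inner) s"
    using b W superharmonic by (intro exits_summable(1)[where W = W]) (auto intro: order_trans[of 0 1])
  then have "(\<lambda>\<pi>. C' ^ 3 * edge_prod b \<pi>) summable_on exits (- inner) s"
    by (rule summable_on_cmult_right)
  moreover have "\<forall>\<^sub>F \<epsilon> in at_right 0. \<forall>\<pi>\<in>exits (- inner) s.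
       0 \<le> edge_prod (q \<epsilon>) \<pi> * tail_moment k (c \<epsilon>) \<epsilon> \<pi> \<and>
       edge_prod (q \<epsilon>) \<pi> * tail_moment k (c \<epsilon>) \<epsilon> \<pi> \<le> C' ^ 3 * edge_prod b \<pi>"
    using eventually_regular Y qb c
  proof eventually_elim
    case (elim \<epsilon>)
    have \<epsilon>: "\<epsilon> \<in> {0<..<\<epsilon>\<^sub>0}"
      using elim(1) by (simp add: regular_def)
    show ?case
    proof
      fix \<pi> assume \<pi>: "\<pi> \<in> exits (- inner) s"
      have b_prod: "0 \<le> edge_prod b \<pi>" and q_prod: "0 \<le> edge_prod (q \<epsilon>) \<pi>"
        using b q_nonneg[OF \<epsilon>] by (intro edge_prod_nonneg; simp)+
      show "0 \<le> edge_prod (q \<epsilon>) \<pi> * tail_moment k (c \<epsilon>) \<epsilon> \<pi> \<and>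
         edge_prod (q \<epsilon>) \<pi> * tail_moment k (c \<epsilon>) \<epsilon> \<pi> \<le> C' ^ 3 * edge_prod b \<pi>"
      proof (cases "last \<pi> \<in> live")
        case False
        then show ?thesis
          using q_prod_zero[OF elim(1) \<pi>] b_prod C' by simp
      next
        case True
        define m where "m = length \<pi> - 1"
        have Rm: "1 \<le> R ^ m"
          using CR(2) by (rule one_le_power)
        have "Y \<epsilon> \<pi> + \<bar>c \<epsilon>\<bar> \<le> C * R ^ m + (\<bar>c0\<bar> + 1)"
          using elim(2,4) \<pi> True unfolding m_def by fastforce
        also have "\<dots> \<le> C * R ^ m + (\<bar>c0\<bar> + 1) * R ^ m"
          using mult_left_mono[OF Rm, of "\<bar>c0\<bar> + 1"] by simp
        also have "\<dots> = C' * R ^ m"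
          by (simp add: C'_def algebra_simps)
        finally have base: "Y \<epsilon> \<pi> + \<bar>c \<epsilon>\<bar> \<le> C' * R ^ m" .
        have "tail_moment k (c \<epsilon>) \<epsilon> \<pi> \<le> (Y \<epsilon> \<pi> + \<bar>c \<epsilon>\<bar>) ^ k"
          by (rule tail_moment_bounds(3)[OF elim(1) \<pi> True])
        also have "\<dots> \<le> (C' * R ^ m) ^ k"
          using base Y_nonneg[OF elim(1) \<pi> True] by (intro power_mono) auto
        also have "\<dots> \<le> (C' * R ^ m) ^ 3"
          using mult_mono[OF C' Rm] C' by (intro power_increasing assms(2)) auto
        also have "\<dots> = C' ^ 3 * (R ^ 3) ^ m"
          by (simp add: power_mult_distrib mult.commute flip: power_mult)
        finally have "edge_prod (q \<epsilon>) \<pi> * tail_moment k (c \<epsilon>) \<epsilon> \<pi>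
            \<le> edge_prod (q \<epsilon>) \<pi> * (C' ^ 3 * (R ^ 3) ^ m)"
          using q_prod by (rule mult_left_mono)
        also have "\<dots> = C' ^ 3 * edge_prod (\<lambda>x y. R ^ 3 * q \<epsilon> x y) \<pi>"
          by (simp add: edge_prod_scale m_def)
        also have "\<dots> \<le> C' ^ 3 * edge_prod b \<pi>"
        proof (intro mult_left_mono edge_prod_mono_exits[OF _ _ \<pi> True])
          show "0 \<le> R ^ 3 * q \<epsilon> x y" for x y
            using CR(2) q_nonneg[OF \<epsilon>] by simp
        qed (use elim(3) C' in auto)
        finally show ?thesis
          using q_prod tail_moment_bounds(2)[OF elim(1) \<pi> True] by simp
      qed
    qed
  qed
  ultimately show thesis
    using that by blast
qed

text \<open>Fubini for nonnegative terms along the decomposition into prefix and continuation; the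
  majorant \<open>D\<close> ensures that the iterated sum is finite.\<close>

lemma infsum_eq_prefix_infsum:
  assumes reg: "regular \<epsilon>" and D: "D summable_on exits (- inner) s"
    and bound: "\<And>\<pi>. \<pi> \<in> exits (- inner) s \<Longrightarrow>
       0 \<le> edge_prod (q \<epsilon>) \<pi> * tail_moment k c \<epsilon> \<pi> \<and>
       edge_prod (q \<epsilon>) \<pi> * tail_moment k c \<epsilon> \<pi> \<le> D \<pi>"
  shows "((\<lambda>\<omega>. IS_prob p s g t v \<epsilon> \<omega> * \<bar>scaled_estimator \<epsilon> \<omega> - c\<bar> ^ k) has_sum
           (\<Sum>\<^sub>\<infinity>\<pi>\<in>exits (- inner) s. edge_prod (q \<epsilon>) \<pi> * tail_moment k c \<epsilon> \<pi>)) (exits {t, g} s)"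
    (is "(?F has_sum ?S) _")
proof -
  have \<epsilon>: "\<epsilon> \<in> {0<..<\<epsilon>\<^sub>0}"
    using reg by (simp add: regular_def)
  let ?G = "\<lambda>(\<pi>, \<sigma>). edge_prod (q \<epsilon>) \<pi> *
    (path_prob p \<epsilon> \<sigma> * \<bar>(if last \<sigma> = g then Y \<epsilon> \<pi> else 0) - c\<bar> ^ k)"
  let ?I = "SIGMA \<pi>:exits (- inner) s. exits {t, g} (last \<pi>)"
  have fiber: "((\<lambda>\<sigma>. ?G (\<pi>, \<sigma>)) has_sum edge_prod (q \<epsilon>) \<pi> * tail_moment k c \<epsilon> \<pi>)
                 (exits {t, g} (last \<pi>))" if \<pi>: "\<pi> \<in> exits (- inner) s" for \<pi>
  proof (cases "last \<pi> \<in> live")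
    case True
    show ?thesis
      unfolding prod.case tail_moment_def
      by (intro has_sum_cmult_right has_sum_infsum tail_moment_bounds(1)[OF reg \<pi> True])
  next
    case False
    then show ?thesis
      using q_prod_zero[OF reg \<pi>] by simp
  qed
  have prefix: "(\<lambda>\<pi>. edge_prod (q \<epsilon>) \<pi> * tail_moment k c \<epsilon> \<pi>) summable_on exits (- inner) s"
    by (rule summable_on_comparison_test[OF D]) (use bound in auto)
  have "?G summable_on ?I"
  proof (rule summable_on_SigmaI[OF fiber prefix])
    show "0 \<le> ?G (\<pi>, \<sigma>)" for \<pi> \<sigma>
      unfolding prod.case
      by (intro mult_nonneg_nonneg edge_prod_nonneg q_nonneg[OF \<epsilon>] path_prob_nonneg[OF \<epsilon>]) simp
  qed
  with fiber prefix have "(?G has_sum ?S) ?I"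
    by (intro has_sum_SigmaI[OF fiber has_sum_infsum])
  moreover have "?G x = ?F (case x of (\<pi>, \<sigma>) \<Rightarrow> butlast \<pi> @ \<sigma>)" if "x \<in> ?I" for x
    using that summand_decomposition[OF reg, where f = "\<lambda>y. \<bar>y - c\<bar> ^ k"] by auto
  ultimately have "((\<lambda>x. ?F (case x of (\<pi>, \<sigma>) \<Rightarrow> butlast \<pi> @ \<sigma>)) has_sum ?S) ?I"
    by (simp cong: has_sum_cong)
  moreover have "bij_betw (\<lambda>(\<pi>, \<sigma>). butlast \<pi> @ \<sigma>) ?I (exits {t, g} s)"
    using innerD(3,4) by (intro exits_decomposition) blast
  ultimately show ?thesis
    using has_sum_reindex_bij_betw[of "\<lambda>(\<pi>, \<sigma>). butlast \<pi> @ \<sigma>" ?I _ ?F] by blast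
qed

text \<open>The centre is a convergent function of the parameter, since it will later be the mean,
  which itself depends on \<epsilon>.\<close>

lemma moment_converges:
  assumes "(c \<longlongrightarrow> c0) (at_right 0)" "k \<le> 3"
  shows "\<forall>\<^sub>F \<epsilon> in at_right 0. (\<lambda>\<omega>. IS_prob p s g t v \<epsilon> \<omega> * \<bar>scaled_estimator \<epsilon> \<omega> - c \<epsilon>\<bar> ^ k)
           summable_on exits {t, g} s"
    and "\<exists>l. ((\<lambda>\<epsilon>. \<Sum>\<^sub>\<infinity>\<omega>\<in>exits {t, g} s.
               IS_prob p s g t v \<epsilon> \<omega> * \<bar>scaled_estimator \<epsilon> \<omega> - c \<epsilon>\<bar> ^ k) \<longlongrightarrow> l) (at_right 0)"
proof -
  obtain D where D: "D summable_on exits (- inner) s"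
    and bound: "\<forall>\<^sub>F \<epsilon> in at_right 0. \<forall>\<pi>\<in>exits (- inner) s.
       0 \<le> edge_prod (q \<epsilon>) \<pi> * tail_moment k (c \<epsilon>) \<epsilon> \<pi> \<and>
       edge_prod (q \<epsilon>) \<pi> * tail_moment k (c \<epsilon>) \<epsilon> \<pi> \<le> D \<pi>"
    using dominating_summable[OF assms] by blast
  have has_sum: "\<forall>\<^sub>F \<epsilon> in at_right 0.
      ((\<lambda>\<omega>. IS_prob p s g t v \<epsilon> \<omega> * \<bar>scaled_estimator \<epsilon> \<omega> - c \<epsilon>\<bar> ^ k) has_sum
        (\<Sum>\<^sub>\<infinity>\<pi>\<in>exits (- inner) s. edge_prod (q \<epsilon>) \<pi> * tail_moment k (c \<epsilon>) \<epsilon> \<pi>)) (exits {t, g} s)"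
    using eventually_regular bound
    by eventually_elim (rule infsum_eq_prefix_infsum[OF _ D], auto)
  then show "\<forall>\<^sub>F \<epsilon> in at_right 0. (\<lambda>\<omega>. IS_prob p s g t v \<epsilon> \<omega> * \<bar>scaled_estimator \<epsilon> \<omega> - c \<epsilon>\<bar> ^ k)
      summable_on exits {t, g} s"
    by (rule eventually_mono) (rule has_sum_imp_summable)
  have "\<forall>\<pi>. \<exists>l. \<pi> \<in> exits (- inner) s \<longrightarrow>
      ((\<lambda>\<epsilon>. edge_prod (q \<epsilon>) \<pi> * tail_moment k (c \<epsilon>) \<epsilon> \<pi>) \<longlongrightarrow> l) (at_right 0)"
    using contribution_tendsto[OF _ assms(1)] by blast
  from choice[OF this] obtain l where l: "\<And>\<pi>. \<pi> \<in> exits (- inner) s \<Longrightarrow>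
      ((\<lambda>\<epsilon>. edge_prod (q \<epsilon>) \<pi> * tail_moment k (c \<epsilon>) \<epsilon> \<pi>) \<longlongrightarrow> l \<pi>) (at_right 0)"
    by blast
  have "\<forall>\<^sub>F \<epsilon> in at_right 0. \<forall>\<pi>\<in>exits (- inner) s.
      \<bar>edge_prod (q \<epsilon>) \<pi> * tail_moment k (c \<epsilon>) \<epsilon> \<pi>\<bar> \<le> D \<pi>"
    using bound by (rule eventually_mono) (metis abs_of_nonneg)
  from infsum_dominated_convergence[OF D this l trivial_limit_at_right_real]
  have "((\<lambda>\<epsilon>. \<Sum>\<^sub>\<infinity>\<pi>\<in>exits (- inner) s. edge_prod (q \<epsilon>) \<pi> * tail_moment k (c \<epsilon>) \<epsilon> \<pi>)
          \<longlongrightarrow> infsum l (exits (- inner) s)) (at_right 0)" .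
  then have "((\<lambda>\<epsilon>. \<Sum>\<^sub>\<infinity>\<omega>\<in>exits {t, g} s.
      IS_prob p s g t v \<epsilon> \<omega> * \<bar>scaled_estimator \<epsilon> \<omega> - c \<epsilon>\<bar> ^ k)
          \<longlongrightarrow> infsum l (exits (- inner) s)) (at_right 0)"
    by (rule Lim_transform_eventually)
       (use has_sum in \<open>rule eventually_mono\<close>, simp add: infsumI)
  then show "\<exists>l. ((\<lambda>\<epsilon>. \<Sum>\<^sub>\<infinity>\<omega>\<in>exits {t, g} s.
      IS_prob p s g t v \<epsilon> \<omega> * \<bar>scaled_estimator \<epsilon> \<omega> - c \<epsilon>\<bar> ^ k) \<longlongrightarrow> l) (at_right 0)"
    by blast
qed


section \<open>From sums over paths to expectations\<close>

lemma IS_prob_nonneg: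
  assumes "\<epsilon> \<in> {0<..<\<epsilon>\<^sub>0}"
  shows "0 \<le> IS_prob p s g t v \<epsilon> \<omega>"
  unfolding IS_prob_def using q_nonneg[OF assms] p_nonneg[OF assms] by (intro prod_nonneg) auto

lemma scaled_estimator_nonneg:
  assumes "\<epsilon> \<in> {0<..<\<epsilon>\<^sub>0}"
  shows "0 \<le> scaled_estimator \<epsilon> \<omega>"
  unfolding scaled_estimator_def IS_estimator_def likelihood_ratio_def
  using assms IS_prob_nonneg[OF assms] path_prob_nonneg[OF assms]
  by (intro divide_nonneg_nonneg mult_nonneg_nonneg) auto

text \<open>A point measure is a density over counting measure, and summability of real families is
  absolute, so the sum is a Bochner integral.\<close>

lemma integral_IS_measure:
  assumes \<epsilon>: "\<epsilon> \<in> {0<..<\<epsilon>\<^sub>0}"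
    and summable: "(\<lambda>\<omega>. IS_prob p s g t v \<epsilon> \<omega> * f \<omega>) summable_on exits {t, g} s"
  shows "integrable (IS_measure p s g t v \<epsilon>) f"
    and "IS_expectation p s g t v \<epsilon> f = (\<Sum>\<^sub>\<infinity>\<omega>\<in>exits {t, g} s. IS_prob p s g t v \<epsilon> \<omega> * f \<omega>)"
proof -
  let ?F = "\<lambda>\<omega>. IS_prob p s g t v \<epsilon> \<omega> * f \<omega>"
  have M: "IS_measure p s g t v \<epsilon> =
      density (count_space (exits {t, g} s)) (\<lambda>\<omega>. ennreal (IS_prob p s g t v \<epsilon> \<omega>))"
    unfolding IS_measure_def point_measure_def paths_between_Un_eq_exits ..
  have "Infinite_Sum.abs_summable_on ?F (exits {t, g} s)"
    by (rule summable_on_iff_abs_summable_on_real[THEN iffD1, OF summable])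
  then have abs: "Infinite_Set_Sum.abs_summable_on ?F (exits {t, g} s)"
    by (simp only: abs_summable_equivalent)
  then show "integrable (IS_measure p s g t v \<epsilon>) f"
    unfolding M using IS_prob_nonneg[OF \<epsilon>]
    by (subst integrable_density) (auto simp: Infinite_Set_Sum.abs_summable_on_def)
  have "IS_expectation p s g t v \<epsilon> f = infsetsum ?F (exits {t, g} s)"
    unfolding M infsetsum_def using IS_prob_nonneg[OF \<epsilon>] by (subst integral_density) auto
  then show "IS_expectation p s g t v \<epsilon> f = infsum ?F (exits {t, g} s)"
    by (simp add: infsetsum_infsum[OF abs])
qed

definition moment :: "nat \<Rightarrow> (real \<Rightarrow> real) \<Rightarrow> real \<Rightarrow> real" where
  "moment k c \<epsilon> = IS_expectation p s g t v \<epsilon> (\<lambda>\<omega>. \<bar>scaled_estimator \<epsilon> \<omega> - c \<epsilon>\<bar> ^ k)"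

lemma moment_tendsto:
  assumes "(c \<longlongrightarrow> c0) (at_right 0)" "k \<le> 3"
  obtains l where "(moment k c \<longlongrightarrow> l) (at_right 0)"
proof -
  obtain l where l: "((\<lambda>\<epsilon>. \<Sum>\<^sub>\<infinity>\<omega>\<in>exits {t, g} s.
      IS_prob p s g t v \<epsilon> \<omega> * \<bar>scaled_estimator \<epsilon> \<omega> - c \<epsilon>\<bar> ^ k) \<longlongrightarrow> l) (at_right 0)"
    using moment_converges(2)[OF assms] by blast
  have "\<forall>\<^sub>F \<epsilon> in at_right 0. (\<Sum>\<^sub>\<infinity>\<omega>\<in>exits {t, g} s.
      IS_prob p s g t v \<epsilon> \<omega> * \<bar>scaled_estimator \<epsilon> \<omega> - c \<epsilon>\<bar> ^ k) = moment k c \<epsilon>"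
    using eventually_small moment_converges(1)[OF assms]
    by eventually_elim (simp add: moment_def integral_IS_measure(2))
  then show thesis
    by (rule that[OF Lim_transform_eventually[OF l]])
qed

definition \<mu> :: "real \<Rightarrow> real" where
  "\<mu> \<epsilon> = IS_expectation p s g t v \<epsilon> (scaled_estimator \<epsilon>)"

lemma eventually_\<mu>_eq: "\<forall>\<^sub>F \<epsilon> in at_right 0. \<mu> \<epsilon> = moment 1 (\<lambda>_. 0) \<epsilon>"
  using eventually_small by eventually_elim (simp add: \<mu>_def moment_def scaled_estimator_nonneg)

text \<open>A single optimal path already contributes a fixed proportion of \<open>\<epsilon>\<^sup>d\<close> to the mean.\<close>

lemma \<mu>_tendsto:
  obtains m where "m > 0" "(\<mu> \<longlongrightarrow> m) (at_right 0)"
proof -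
  obtain m where m: "(moment 1 (\<lambda>_. 0) \<longlongrightarrow> m) (at_right 0)"
    using moment_tendsto[OF tendsto_const, of 1] by auto
  then have \<mu>: "(\<mu> \<longlongrightarrow> m) (at_right 0)"
    by (rule Lim_transform_eventually) (use eventually_\<mu>_eq in eventually_elim, simp)
  obtain \<pi> where \<pi>: "\<pi> \<in> paths_between g t s g" "edge_sum r \<pi> = enat d" "set \<pi> \<subseteq> live \<inter> \<Lambda>"
    using optimal_path enat_d(1) by auto
  have \<pi>_exits: "\<pi> \<in> exits (- inner) s" and last: "last \<pi> = g"
    using \<pi>(1,3) in_set_butlastD[of _ \<pi>] by (auto simp: exits_def inner_def paths_between_iff)
  have g_live: "g \<in> live"
    using outer_cases by (auto simp: outer_def)
  have "is_Theta (\<lambda>\<epsilon>. path_prob p \<epsilon> \<pi>) (\<lambda>\<epsilon>. \<epsilon> ^ d)"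
    using order_of_path_prob[OF kernel_rate_p, of \<pi>] \<pi>(2) by simp
  then obtain c where c: "c > 0" "((\<lambda>\<epsilon>. path_prob p \<epsilon> \<pi> / \<epsilon> ^ d) \<longlongrightarrow> c) (at_right 0)"
    unfolding is_Theta_def by blast
  have "\<forall>\<^sub>F \<epsilon> in at_right 0.
      (\<lambda>\<omega>. IS_prob p s g t v \<epsilon> \<omega> * \<bar>scaled_estimator \<epsilon> \<omega> - 0\<bar> ^ 1) summable_on exits {t, g} s"
    by (rule moment_converges(1)[OF tendsto_const]) simp
  with eventually_regular eventually_\<mu>_eq
  have "\<forall>\<^sub>F \<epsilon> in at_right 0. path_prob p \<epsilon> \<pi> / \<epsilon> ^ d \<le> \<mu> \<epsilon>"
  proof eventually_elim
    case (elim \<epsilon>)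
    have \<epsilon>: "\<epsilon> \<in> {0<..<\<epsilon>\<^sub>0}"
      using elim(1) by (simp add: regular_def)
    let ?F = "\<lambda>\<omega>. IS_prob p s g t v \<epsilon> \<omega> * \<bar>scaled_estimator \<epsilon> \<omega> - 0\<bar> ^ 1"
    have summable: "?F summable_on exits {t, g} s"
      using elim(3) by simp
    have path: "butlast \<pi> @ [g] = \<pi>"
      using \<pi>(1) last by (metis append_butlast_last_id Nil_notin_paths_between)
    \<comment> \<open>The optimal path ends in \<open>g\<close> at its exit, so it is at once a
      prefix and a complete sample path, and its term is one summand of the mean.\<close>
    have "path_prob p \<epsilon> \<pi> / \<epsilon> ^ d = edge_prod (q \<epsilon>) \<pi> * Y \<epsilon> \<pi>"
      using p_prod_eq_Y[OF elim(1) \<pi>_exits] last g_live by (simp add: path_prob_eq_edge_prod)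
    also have "\<dots> = ?F \<pi>"
      using summand_decomposition[OF elim(1) \<pi>_exits, of "[g]" "\<lambda>y. \<bar>y - 0\<bar> ^ 1"] path last
        Y_nonneg[OF elim(1) \<pi>_exits] g_live by (simp add: path_prob_def)
    also have "\<dots> = sum ?F {\<pi>}"
      by simp
    also have "\<dots> \<le> infsum ?F (exits {t, g} s)"
    proof (rule finite_sum_le_infsum[OF summable])
      show "{\<pi>} \<subseteq> exits {t, g} s"
        using \<pi>(1) paths_between_Un_eq_exits[of g t s] by blast
      show "0 \<le> ?F \<omega>" for \<omega>
        using IS_prob_nonneg[OF \<epsilon>] by simp
    qed simp
    also have "\<dots> = \<mu> \<epsilon>"
      using elim(2) integral_IS_measure(2)[OF \<epsilon> summable] by (simp add: moment_def)
    finally show ?case .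
  qed
  then have "c \<le> m"
    using c(2) \<mu> by (intro tendsto_le[OF trivial_limit_at_right_real])
  then show thesis
    using that[of m] c(1) \<mu> by simp
qed

text \<open>Homogeneity of the moments. A constant factor leaves a Bochner integral even without
  integrability, so the identities hold for every positive parameter.\<close>

lemma estimator_scaling:
  assumes "\<epsilon> > 0"
  shows "IS_estimator p s g t v \<epsilon> = (\<lambda>\<omega>. \<epsilon> ^ d * scaled_estimator \<epsilon> \<omega>)"
    and "IS_expectation p s g t v \<epsilon> (IS_estimator p s g t v \<epsilon>) = \<epsilon> ^ d * \<mu> \<epsilon>"
    and "\<bar>IS_estimator p s g t v \<epsilon> \<omega> - IS_expectation p s g t v \<epsilon> (IS_estimator p s g t v \<epsilon>)\<bar> ^ k
           = \<epsilon> ^ (k * d) * \<bar>scaled_estimator \<epsilon> \<omega> - \<mu> \<epsilon>\<bar> ^ k"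
    and "IS_expectation p s g t v \<epsilon> (\<lambda>\<omega>. \<bar>IS_estimator p s g t v \<epsilon> \<omega>
             - IS_expectation p s g t v \<epsilon> (IS_estimator p s g t v \<epsilon>)\<bar> ^ k)
           = \<epsilon> ^ (k * d) * moment k \<mu> \<epsilon>"
    and "IS_variance p s g t v \<epsilon> (IS_estimator p s g t v \<epsilon>) = \<epsilon> ^ (2 * d) * moment 2 \<mu> \<epsilon>"
proof -
  show X: "IS_estimator p s g t v \<epsilon> = (\<lambda>\<omega>. \<epsilon> ^ d * scaled_estimator \<epsilon> \<omega>)"
    using assms by (simp add: scaled_estimator_def fun_eq_iff)
  show E: "IS_expectation p s g t v \<epsilon> (IS_estimator p s g t v \<epsilon>) = \<epsilon> ^ d * \<mu> \<epsilon>"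
    unfolding X \<mu>_def by simp
  show pow: "\<bar>IS_estimator p s g t v \<epsilon> \<omega> - IS_expectation p s g t v \<epsilon> (IS_estimator p s g t v \<epsilon>)\<bar> ^ k
      = \<epsilon> ^ (k * d) * \<bar>scaled_estimator \<epsilon> \<omega> - \<mu> \<epsilon>\<bar> ^ k" for \<omega> k
  proof -
    have "IS_estimator p s g t v \<epsilon> \<omega> - IS_expectation p s g t v \<epsilon> (IS_estimator p s g t v \<epsilon>)
        = \<epsilon> ^ d * (scaled_estimator \<epsilon> \<omega> - \<mu> \<epsilon>)"
      unfolding E by (simp add: X right_diff_distrib)
    then show ?thesis
      using assms by (simp add: abs_mult power_mult_distrib mult.commute[of k] flip: power_mult)
  qed
  show moments: "IS_expectation p s g t v \<epsilon> (\<lambda>\<omega>. \<bar>IS_estimator p s g t v \<epsilon> \<omega>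
         - IS_expectation p s g t v \<epsilon> (IS_estimator p s g t v \<epsilon>)\<bar> ^ k)
       = \<epsilon> ^ (k * d) * moment k \<mu> \<epsilon>" for k
    unfolding pow moment_def by simp
  show "IS_variance p s g t v \<epsilon> (IS_estimator p s g t v \<epsilon>) = \<epsilon> ^ (2 * d) * moment 2 \<mu> \<epsilon>"
    using moments[of 2] by (simp only: power2_abs)
qed

text \<open>Integrability is asserted separately because a Bochner integral takes the value 0 on
  non-integrable functions, which would make the bound meaningless.\<close>

lemma bounded_normal_approximation:
  assumes "\<not> vanishing_relative_error p s g t v"
  shows "\<forall>\<^sub>F \<epsilon> in at_right 0. integrable (IS_measure p s g t v \<epsilon>)
           (\<lambda>\<omega>. \<bar>IS_estimator p s g t v \<epsilon> \<omega>
             - IS_expectation p s g t v \<epsilon> (IS_estimator p s g t v \<epsilon>)\<bar> ^ 3)"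
    and "is_bigO
           (\<lambda>\<epsilon>. IS_expectation p s g t v \<epsilon> (\<lambda>\<omega>. \<bar>IS_estimator p s g t v \<epsilon> \<omega>
                   - IS_expectation p s g t v \<epsilon> (IS_estimator p s g t v \<epsilon>)\<bar> ^ 3)
                 / (IS_variance p s g t v \<epsilon> (IS_estimator p s g t v \<epsilon>)) powr (3 / 2))
           (\<lambda>\<epsilon>. 1)"
proof -
  obtain m where m: "m > 0" "(\<mu> \<longlongrightarrow> m) (at_right 0)"
    using \<mu>_tendsto by blast
  obtain V where V: "(moment 2 \<mu> \<longlongrightarrow> V) (at_right 0)"
    using moment_tendsto[OF m(2), of 2] by auto
  obtain T where T: "(moment 3 \<mu> \<longlongrightarrow> T) (at_right 0)"
    using moment_tendsto[OF m(2), of 3] by auto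
  note pos = eventually_at_right_less[of "0::real"]
  show "\<forall>\<^sub>F \<epsilon> in at_right 0. integrable (IS_measure p s g t v \<epsilon>)
           (\<lambda>\<omega>. \<bar>IS_estimator p s g t v \<epsilon> \<omega>
             - IS_expectation p s g t v \<epsilon> (IS_estimator p s g t v \<epsilon>)\<bar> ^ 3)"
    using pos eventually_small moment_converges(1)[OF m(2) order_refl]
    by eventually_elim (simp only: estimator_scaling(3), intro integrable_mult_right integral_IS_measure(1))
  have nonneg: "0 \<le> moment 2 \<mu> \<epsilon>" for \<epsilon>
    unfolding moment_def by (intro integral_nonneg_AE) auto
  then have "0 \<le> V"
    using V by (intro tendsto_lowerbound[OF V]) auto
  \<comment> \<open>Since the rescaled mean has a positive limit, a vanishing limit of the rescaled
    variance would amount to vanishing relative error.\<close>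
  have "V \<noteq> 0"
  proof
    assume "V = 0"
    then have "((\<lambda>\<epsilon>. moment 2 \<mu> \<epsilon> / (\<mu> \<epsilon>)\<^sup>2) \<longlongrightarrow> 0 / m\<^sup>2) (at_right 0)"
      using V m by (intro tendsto_intros) auto
    then have "vanishing_relative_error p s g t v"
      unfolding vanishing_relative_error_def div_0
    proof (rule Lim_transform_eventually)
      show "\<forall>\<^sub>F \<epsilon> in at_right 0. moment 2 \<mu> \<epsilon> / (\<mu> \<epsilon>)\<^sup>2
          = IS_variance p s g t v \<epsilon> (IS_estimator p s g t v \<epsilon>)
            / (IS_expectation p s g t v \<epsilon> (IS_estimator p s g t v \<epsilon>))\<^sup>2"
        using pos
      proof eventually_elim
        case (elim \<epsilon>)
        then show ?case
          unfolding estimator_scaling(5)[OF elim]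
          unfolding estimator_scaling(2)[OF elim]
          by (simp add: power_mult_distrib mult.commute[of 2 d] flip: power_mult)
      qed
    qed
    then show False
      using assms by blast
  qed
  with \<open>0 \<le> V\<close> have "V > 0"
    by simp
  have "((\<lambda>\<epsilon>. moment 3 \<mu> \<epsilon> / moment 2 \<mu> \<epsilon> powr (3 / 2)) \<longlongrightarrow> T / V powr (3 / 2)) (at_right 0)"
    using \<open>V > 0\<close> by (intro tendsto_divide tendsto_powr T V tendsto_const) auto
  moreover have "\<forall>\<^sub>F \<epsilon> in at_right 0. moment 3 \<mu> \<epsilon> / moment 2 \<mu> \<epsilon> powr (3 / 2)
      = IS_expectation p s g t v \<epsilon> (\<lambda>\<omega>. \<bar>IS_estimator p s g t v \<epsilon> \<omega>
          - IS_expectation p s g t v \<epsilon> (IS_estimator p s g t v \<epsilon>)\<bar> ^ 3)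
        / (IS_variance p s g t v \<epsilon> (IS_estimator p s g t v \<epsilon>)) powr (3 / 2) / 1"
    using pos
  proof eventually_elim
    case (elim \<epsilon>)
    \<comment> \<open>The scaling factors of numerator and denominator coincide and cancel.\<close>
    have "(\<epsilon> ^ (2 * d)) powr (3 / 2) = \<epsilon> ^ (3 * d)"
      using elim by (simp add: powr_powr flip: powr_realpow)
    then show ?case
      unfolding estimator_scaling(4)[OF elim] estimator_scaling(5)[OF elim]
      using elim nonneg[of \<epsilon>] by (simp add: powr_mult)
  qed
  ultimately show "is_bigO
      (\<lambda>\<epsilon>. IS_expectation p s g t v \<epsilon> (\<lambda>\<omega>. \<bar>IS_estimator p s g t v \<epsilon> \<omega>
              - IS_expectation p s g t v \<epsilon> (IS_estimator p s g t v \<epsilon>)\<bar> ^ 3)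
            / (IS_variance p s g t v \<epsilon> (IS_estimator p s g t v \<epsilon>)) powr (3 / 2))
      (\<lambda>\<epsilon>. 1)"
    unfolding is_bigO_def by (blast intro: Lim_transform_eventually)
qed

end

theorem theorem4p7:
  fixes \<epsilon>\<^sub>0 :: real
    and p :: "real \<Rightarrow> 'a::countable \<Rightarrow> 'a \<Rightarrow> real"
    and r :: "'a \<Rightarrow> 'a \<Rightarrow> enat"
    and s g t :: 'a
    and v :: "real \<Rightarrow> 'a \<Rightarrow> real"
  assumes chain: "rare_event_chain \<epsilon>\<^sub>0 p r s g t"
    and v_nonneg: "\<And>\<epsilon> x. \<epsilon> \<in> {0<..<\<epsilon>\<^sub>0} \<Longrightarrow> v \<epsilon> x \<ge> 0"
    and v_Theta: "Theta_powers_uniformly v (\<lambda>x. rate_dist (modified p s g t) g t x g)"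
    and not_VRE: "\<not> vanishing_relative_error p s g t v"
  shows "(\<forall>\<^sub>F \<epsilon> in at_right 0.
            integrable (IS_measure p s g t v \<epsilon>)
              (\<lambda>\<omega>. \<bar>IS_estimator p s g t v \<epsilon> \<omega>
                     - IS_expectation p s g t v \<epsilon> (IS_estimator p s g t v \<epsilon>)\<bar> ^ 3)) \<and>
         is_bigO
           (\<lambda>\<epsilon>. IS_expectation p s g t v \<epsilon>
                   (\<lambda>\<omega>. \<bar>IS_estimator p s g t v \<epsilon> \<omega>
                          - IS_expectation p s g t v \<epsilon> (IS_estimator p s g t v \<epsilon>)\<bar> ^ 3)
                 / (IS_variance p s g t v \<epsilon> (IS_estimator p s g t v \<epsilon>)) powr (3 / 2))
           (\<lambda>\<epsilon>. 1)"
proof -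
  interpret rare_event_chain \<epsilon>\<^sub>0 p r s g t
    by (rule chain)
  interpret importance_sampling \<epsilon>\<^sub>0 p r s g t v
    by unfold_locales (fact v_nonneg, fact v_Theta)
  show ?thesis
    using bounded_normal_approximation[OF not_VRE] by blast
qed

end
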